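(* Let $\Sigma_{[\mathbb{D}_3]}\subset\mathbb{E}\mathrm{la}$ be the trigonal stratum. For a trigonal elasticity tensor $\mathbf{E}=(\operatorname{tr}\mathbf{d},\operatorname{tr}\mathbf{v},\mathbf{d}',\mathbf{v}',\mathbf{H})\in\Sigma_{[\mathbb{D}_3]}$ set $$\mathbf{t}:=2\,\frac{\left(\|\mathbf{d}'\|^2\,\mathbf{d}'^2+\|\mathbf{v}'\|^2\,\mathbf{v}'^2+\mathbf{d}_2'^2\right)'}{\|\mathbf{d}'\|^4+\|\mathbf{v}'\|^4+\|\mathbf{d}_2'\|^2}.$$ A minimal functional basis for $\Sigma_{[\mathbb{D}_3]}$ (under the action of $\mathrm{SO}(3)$) consists of the six rational invariants $$\kappa_1:=\operatorname{tr}\mathbf{d},\quad \kappa_2:=\operatorname{tr}\mathbf{v},\quad \kappa_3:=\mathbf{d}:\mathbf{t},\quad \kappa_4:=\mathbf{v}:\mathbf{t},\quad \kappa_5:=\mathbf{t}:\mathbf{H}:\mathbf{t},\quad \kappa_6:=I_2.$$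
   Context: Tensors are on Euclidean $\mathbb{R}^3$, with components in an orthonormal basis $(e_i)$ and summation over repeated indices; $\mathbf{q}=(\delta_{ij})$ is the Euclidean metric. $\mathrm{SO}(3)$ acts on $n$th-order tensors by $(g\star \mathbf{T})_{i_1\dots i_n}=g_{i_1j_1}\cdots g_{i_nj_n}T_{j_1\dots j_n}$. $\mathbb{E}\mathrm{la}=\{\mathbf{E}\in\otimes^4(\mathbb{R}^3):E_{ijkl}=E_{klij}=E_{jikl}\}$ is the 21-dimensional space of elasticity tensors. $\mathbf{T}^s$ denotes the total symmetrization and $\mathbf{S}_1\odot\mathbf{S}_2:=(\mathbf{S}_1\otimes\mathbf{S}_2)^s$. For symmetric second-order tensors: $\mathbf{a}'=\mathbf{a}-\frac13(\operatorname{tr}\mathbf{a})\mathbf{q}$ (deviatoric part), $\mathbf{a}'^2=(\mathbf{a}')^2$ is the matrix square, $\mathbf{a}:\mathbf{b}=a_{ij}b_{ij}$, $\|\mathbf{a}\|^2=\mathbf{a}:\mathbf{a}$, and $\mathbf{a}:\mathbf{H}:\mathbf{b}=a_{ij}H_{ijkl}b_{kl}$. Harmonic decomposition: for $\mathbf{E}\in\mathbb{E}\mathrm{la}$, $d_{ij}=E_{kkij}$, $v_{ij}=E_{kikj}$, $\mathbf{a}=\frac27(\mathbf{d}+2\mathbf{v})$ and $\mathbf{H}=\mathbf{E}^s-\mathbf{q}\odot\mathbf{a}'-\frac{7}{30}(\operatorname{tr}\mathbf{a})\,\mathbf{q}\odot\mathbf{q}$, which is a totally symmetric traceless fourth-order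 tensor. The tensor $\mathbf{E}$ is identified with the tuple $(\operatorname{tr}\mathbf{d},\operatorname{tr}\mathbf{v},\mathbf{d}',\mathbf{v}',\mathbf{H})$ (an $\mathrm{SO}(3)$-equivariant linear isomorphism). Also $(\mathbf{d}_2)_{ij}=H_{ipqr}H_{pqrj}$ and $I_2=\operatorname{tr}\mathbf{d}_2$. For every trigonal $\mathbf{E}$ one has $\|\mathbf{d}'\|^4+\|\mathbf{v}'\|^4+\|\mathbf{d}_2'\|^2\neq0$, so that $\mathbf{t}$ is well defined. Stratum: for a subgroup $K$ of $\mathrm{SO}(3)$, $\Sigma_{[K]}$ is the set of tensors whose symmetry group $\{g\in\mathrm{SO}(3):g\star\mathbf{E}=\mathbf{E}\}$ is conjugate to $K$ in $\mathrm{SO}(3)$. $\mathbb{D}_3$ is the order-6 subgroup generated by the rotation by $2\pi/3$ about $e_3$ and the rotation by $\pi$ about $e_1$. A tensor is trigonal if it belongs to $\Sigma_{[\mathbb{D}_3]}$. Functional basis: a finite set $\{\varphi_1,\dots,\varphi_s\}$ of $\mathrm{SO}(3)$-invariant real functions on an $\mathrm{SO}(3)$-stable set $X$ is a functional basis for $X$ if for every $\mathrm{SO}(3)$-invariant function $f:X\to\mathbb{R}$ there is a function $F:\mathbb{R}^s\to\mathbb{R}$ (no regularity required) with $f(x)=F(\varphi_1(x),\dots,\varphi_s(x))$ for all $x\in X$. It is minimal if no proper subset of it is a functional basis for $X$. *)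

theory Defs
  imports "HOL-Analysis.Analysis" "HOL-Algebra.Generated_Groups"
begin

type_synonym tensor2 = "real^3^3"
type_synonym tensor4 = "real^3^3^3^3"

subsection \<open>The rotation group and its action\<close>

definition SO3 :: "(real^3^3) monoid" where
  "SO3 = \<lparr>carrier = {g. rotation_matrix g}, mult = (**), one = mat 1\<rparr>"

lemma group_SO3: "group SO3"
proof (rule groupI)
  fix g assume "g \<in> carrier SO3"
  then have "transpose g \<in> carrier SO3" "transpose g \<otimes>\<^bsub>SO3\<^esub> g = \<one>\<^bsub>SO3\<^esub>"
    by (simp_all add: SO3_def rotation_matrix_def orthogonal_matrix_def
        det_transpose)
  then show "\<exists>h\<in>carrier SO3. h \<otimes>\<^bsub>SO3\<^esub> g = \<one>\<^bsub>SO3\<^esub>" by blast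
qed (auto simp: SO3_def rotation_matrix_def orthogonal_matrix_mul orthogonal_matrix_id det_mul
    matrix_mul_assoc)

definition act4 :: "real^3^3 \<Rightarrow> tensor4 \<Rightarrow> tensor4" where
  "act4 g T = (\<chi> i j k l. \<Sum>p\<in>UNIV. \<Sum>q\<in>UNIV. \<Sum>r\<in>UNIV. \<Sum>s\<in>UNIV.
     g$i$p * g$j$q * g$k$r * g$l$s * T$p$q$r$s)"

definition rot_e3 :: "real \<Rightarrow> real^3^3" where
  "rot_e3 \<theta> = vector [vector [cos \<theta>, - sin \<theta>, 0],
                      vector [sin \<theta>,   cos \<theta>, 0],
                      vector [0, 0, 1]]"

definition rot_e1 :: "real \<Rightarrow> real^3^3" where
  "rot_e1 \<theta> = vector [vector [1, 0, 0],
                      vector [0, cos \<theta>, - sin \<theta>],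
                      vector [0, sin \<theta>,   cos \<theta>]]"

definition D3 :: "(real^3^3) set" where
  "D3 = generate SO3 {rot_e3 (2 * pi / 3), rot_e1 pi}"

subsection \<open>Elasticity tensors and strata\<close>

definition Ela :: "tensor4 set" where
  "Ela = {E. \<forall>i j k l. E$i$j$k$l = E$k$l$i$j \<and> E$i$j$k$l = E$j$i$k$l}"

definition symmetry_group :: "tensor4 \<Rightarrow> (real^3^3) set" where
  "symmetry_group E = {g \<in> carrier SO3. act4 g E = E}"

definition conjugate_in_SO3 :: "(real^3^3) set \<Rightarrow> (real^3^3) set \<Rightarrow> bool" where
  "conjugate_in_SO3 H K \<longleftrightarrow>
     (\<exists>g\<in>carrier SO3. H = (\<lambda>k. g \<otimes>\<^bsub>SO3\<^esub> k \<otimes>\<^bsub>SO3\<^esub> inv\<^bsub>SO3\<^esub> g) ` K)"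

definition stratum :: "(real^3^3) set \<Rightarrow> tensor4 set" where
  "stratum K = {E \<in> Ela. conjugate_in_SO3 (symmetry_group E) K}"

subsection \<open>Tensor operations\<close>

text \<open>
  The library's inner product and norm on \<^typ>\<open>real^3^3\<close> are the double contraction
  \<open>a : b\<close> and the associated Frobenius norm. Matrix squares have to be written with \<open>**\<close>, since
  \<open>*\<close> and \<open>^\<close> act componentwise on this type.
\<close>

definition deviator :: "tensor2 \<Rightarrow> tensor2" where
  "deviator a = a - (trace a / 3) *\<^sub>R mat 1"

definition tensor_prod :: "tensor2 \<Rightarrow> tensor2 \<Rightarrow> tensor4" where
  "tensor_prod a b = (\<chi> i j k l. a$i$j * b$k$l)"

definition total_sym :: "tensor4 \<Rightarrow> tensor4" where
  "total_sym T = (\<chi> i j k l. (1 / fact 4) *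
     (\<Sum>\<sigma> | \<sigma> permutes {..<4::nat}.
        let n = (\<lambda>m. [i, j, k, l] ! \<sigma> m) in T $ n 0 $ n 1 $ n 2 $ n 3))"

definition sym_prod :: "tensor2 \<Rightarrow> tensor2 \<Rightarrow> tensor4" where
  "sym_prod a b = total_sym (tensor_prod a b)"

text \<open>\<open>a : H : b\<close>\<close>
definition contract4 :: "tensor2 \<Rightarrow> tensor4 \<Rightarrow> tensor2 \<Rightarrow> real" where
  "contract4 a H b =
     (\<Sum>i\<in>UNIV. \<Sum>j\<in>UNIV. \<Sum>k\<in>UNIV. \<Sum>l\<in>UNIV. a$i$j * H$i$j$k$l * b$k$l)"

subsection \<open>Harmonic decomposition and covariants\<close>

definition ela_d :: "tensor4 \<Rightarrow> tensor2" where
  "ela_d E = (\<chi> i j. \<Sum>k\<in>UNIV. E$k$k$i$j)"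

definition ela_v :: "tensor4 \<Rightarrow> tensor2" where
  "ela_v E = (\<chi> i j. \<Sum>k\<in>UNIV. E$k$i$k$j)"

definition ela_a :: "tensor4 \<Rightarrow> tensor2" where
  "ela_a E = (2 / 7) *\<^sub>R (ela_d E + 2 *\<^sub>R ela_v E)"

definition ela_H :: "tensor4 \<Rightarrow> tensor4" where
  "ela_H E = total_sym E - sym_prod (mat 1) (deviator (ela_a E))
     - (7 / 30 * trace (ela_a E)) *\<^sub>R sym_prod (mat 1) (mat 1)"

definition ela_d2 :: "tensor4 \<Rightarrow> tensor2" where
  "ela_d2 E = (let H = ela_H E in
     (\<chi> i j. \<Sum>p\<in>UNIV. \<Sum>q\<in>UNIV. \<Sum>r\<in>UNIV. H$i$p$q$r * H$p$q$r$j))"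

definition ela_I2 :: "tensor4 \<Rightarrow> real" where
  "ela_I2 E = trace (ela_d2 E)"

definition ela_t :: "tensor4 \<Rightarrow> tensor2" where
  "ela_t E = (let d' = deviator (ela_d E); v' = deviator (ela_v E); d2' = deviator (ela_d2 E) in
     (2 / (norm d' ^ 4 + norm v' ^ 4 + (norm d2')\<^sup>2)) *\<^sub>R
       deviator ((norm d')\<^sup>2 *\<^sub>R (d' ** d') + (norm v')\<^sup>2 *\<^sub>R (v' ** v') + d2' ** d2'))"

subsection \<open>Functional bases\<close>

definition SO3_stable :: "tensor4 set \<Rightarrow> bool" where
  "SO3_stable X \<longleftrightarrow> (\<forall>g\<in>carrier SO3. \<forall>x\<in>X. act4 g x \<in> X)"

definition SO3_invariant_on :: "tensor4 set \<Rightarrow> (tensor4 \<Rightarrow> real) \<Rightarrow> bool" where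
  "SO3_invariant_on X f \<longleftrightarrow> (\<forall>g\<in>carrier SO3. \<forall>x\<in>X. f (act4 g x) = f x)"

text \<open>
  A finite set \<open>{\<phi>\<^sub>1, \<dots>, \<phi>\<^sub>s}\<close> of functions is given by a list of length \<open>s\<close>; \<open>F\<close> is only ever
  evaluated at lists of length \<open>s\<close>, that is, at points of \<open>\<real>\<^sup>s\<close>.
\<close>
definition functional_basis :: "tensor4 set \<Rightarrow> (tensor4 \<Rightarrow> real) list \<Rightarrow> bool" where
  "functional_basis X \<phi>s \<longleftrightarrow>
     SO3_stable X \<and> (\<forall>\<phi>\<in>set \<phi>s. SO3_invariant_on X \<phi>) \<and>
     (\<forall>f. SO3_invariant_on X f \<longrightarrow>
        (\<exists>F :: real list \<Rightarrow> real. \<forall>x\<in>X. f x = F (map (\<lambda>\<phi>. \<phi> x) \<phi>s)))"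

text \<open>
  Proper subsets are proper sublists, selected by sets of positions. In particular the members of
  a minimal functional basis are pairwise distinct as functions on \<open>X\<close>.
\<close>
definition minimal_functional_basis :: "tensor4 set \<Rightarrow> (tensor4 \<Rightarrow> real) list \<Rightarrow> bool" where
  "minimal_functional_basis X \<phi>s \<longleftrightarrow>
     functional_basis X \<phi>s \<and> (\<forall>J. J \<subset> {..<length \<phi>s} \<longrightarrow> \<not> functional_basis X (nths \<phi>s J))"

end

theory Submission
  imports Defs
begin

text \<open>
  All tensors built from \<open>E\<close> are equivariant, so the six functions are invariant, and up to a
  rotation a trigonal tensor has symmetry group exactly \<^const>\<open>D3\<close> (\<open>stratum_representative\<close>). Tensors
  fixed by \<^const>\<open>D3\<close> form the six-parameter family \<open>trig\<close> (\<open>D3_fixed_imp_trig\<close>), given by the usual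
  elastic constants. Here \<open>d\<close> and \<open>v\<close> are diagonal with axis \<open>e\<^sub>3\<close>, and \<open>H\<close> has two parameters, \<open>h =
  H\<^sub>3\<^sub>3\<^sub>3\<^sub>3\<close> and \<open>s = H\<^sub>1\<^sub>1\<^sub>2\<^sub>3 = c14\<close>.

  The tensor \<open>t\<close> is designed to extract the threefold axis: on this family it is the constant
  deviator of \<open>e\<^sub>3 \<otimes> e\<^sub>3\<close> (\<open>t_trig\<close>). Its denominator is nonzero, since otherwise \<open>d\<close> and \<open>v\<close> are
  spherical and \<open>25 h\<^sup>2 = 32 s\<^sup>2\<close>; such a tensor has the symmetry of a cube with body diagonal \<open>e\<^sub>3\<close>,
  or more, and a rotation about an edge of this cube is not in \<^const>\<open>D3\<close> (\<open>cubic_fixed\<close>,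
  \<open>symmetry_D3_trig\<close>). Consequently the first five invariants determine linearly the diagonal
  entries of \<open>d\<close> and \<open>v\<close> and the number \<open>h\<close>, hence all elastic constants except \<open>c14\<close>, and the sixth
  is \<open>35/8 h\<^sup>2 + 16 s\<^sup>2\<close>. So they determine the tensor up to the sign of \<open>c14\<close>. The rotation by \<open>\<pi>\<close>
  about \<open>e\<^sub>3\<close> changes this sign, so the invariants separate the orbits (\<open>kappas_separate\<close>), and any
  invariant function is a function of them.

  For minimality, \<open>trig\<close> has symmetry group exactly \<^const>\<open>D3\<close> as soon as \<open>c14 \<noteq> 0\<close> and one of \<open>d\<close> and \<open>v\<close>
  is not spherical (\<open>trig_symmetry_group\<close>). Under this condition the first five values can be
  prescribed freely, together with \<open>s \<noteq> 0\<close> (\<open>kappas_surj\<close>). This allows each invariant to be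
  varied while the other five stay fixed; the fifth is varied by replacing \<open>h\<close> with \<open>-h\<close>.
\<close>

section \<open>Contraction of rotated indices\<close>

text \<open>
  The action of a rotation \<open>g\<close> on second-order tensors, \<open>(g \<star> a)\<^sub>i\<^sub>j = g\<^sub>i\<^sub>p g\<^sub>j\<^sub>q a\<^sub>p\<^sub>q\<close>, written as a
  matrix product.
\<close>
definition act2 :: "real^3^3 \<Rightarrow> tensor2 \<Rightarrow> tensor2" where
  "act2 g a = g ** a ** transpose g"

lemma act2_nth: "act2 g a $ i $ j = (\<Sum>p\<in>UNIV. \<Sum>q\<in>UNIV. g$i$p * g$j$q * a$p$q)"
  unfolding act2_def matrix_matrix_mult_def transpose_def
  by (subst sum.swap) (simp add: sum_distrib_left sum_distrib_right mult_ac)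

lemma act4_nested:
  "act4 g T $ i $ j $ k $ l =
     (\<Sum>p\<in>UNIV. g$i$p * (\<Sum>q\<in>UNIV. g$j$q * (\<Sum>r\<in>UNIV. g$k$r * (\<Sum>s\<in>UNIV. g$l$s * T$p$q$r$s))))"
  by (simp add: act4_def sum_distrib_left mult.assoc)

text \<open>
  Contracting an index of two rotated tensors removes the rotation. The factors \<open>x\<close> and \<open>y\<close> stand
  for tensors whose other indices are already dealt with; the versions for two and three
  contracted indices follow by reordering sums.
\<close>
lemma orthogonal_contract:
  assumes "orthogonal_matrix (g :: real^3^3)"
  shows "(\<Sum>p\<in>UNIV. (\<Sum>a\<in>UNIV. g$p$a * x a) * (\<Sum>b\<in>UNIV. g$p$b * y b))
       = (\<Sum>a\<in>UNIV. x a * y a)"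
proof -
  have "(g *v (\<chi> a. x a)) \<bullet> (g *v (\<chi> a. y a)) = (\<chi> a. x a) \<bullet> (\<chi> a. y a)"
    using assms orthogonal_transformation_matrix[of "(*v) g"]
    by (simp add: orthogonal_transformation_def)
  then show ?thesis by (simp add: inner_vec_def matrix_vector_mult_def)
qed

lemma orthogonal_contract2:
  assumes "orthogonal_matrix (g :: real^3^3)"
  shows "(\<Sum>p\<in>UNIV. \<Sum>q\<in>UNIV. (\<Sum>b\<in>UNIV. g$p$b * (\<Sum>c\<in>UNIV. g$q$c * F b c)) *
           (\<Sum>b\<in>UNIV. g$p$b * (\<Sum>c\<in>UNIV. g$q$c * G b c)))
       = (\<Sum>b\<in>UNIV. \<Sum>c\<in>UNIV. F b c * G b c)"
  by (subst sum.swap, subst orthogonal_contract[OF assms], subst sum.swap,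
      subst orthogonal_contract[OF assms]) (rule refl)

lemma orthogonal_contract3:
  assumes "orthogonal_matrix (g :: real^3^3)"
  shows "(\<Sum>p\<in>UNIV. \<Sum>q\<in>UNIV. \<Sum>r\<in>UNIV.
           (\<Sum>b\<in>UNIV. g$p$b * (\<Sum>c\<in>UNIV. g$q$c * (\<Sum>d\<in>UNIV. g$r$d * F b c d))) *
           (\<Sum>b\<in>UNIV. g$p$b * (\<Sum>c\<in>UNIV. g$q$c * (\<Sum>d\<in>UNIV. g$r$d * G b c d))))
       = (\<Sum>b\<in>UNIV. \<Sum>c\<in>UNIV. \<Sum>d\<in>UNIV. F b c d * G b c d)" (is "?l = _")
proof -
  have "?l = (\<Sum>r\<in>UNIV. \<Sum>p\<in>UNIV. \<Sum>q\<in>UNIV.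
           (\<Sum>b\<in>UNIV. g$p$b * (\<Sum>c\<in>UNIV. g$q$c * (\<Sum>d\<in>UNIV. g$r$d * F b c d))) *
           (\<Sum>b\<in>UNIV. g$p$b * (\<Sum>c\<in>UNIV. g$q$c * (\<Sum>d\<in>UNIV. g$r$d * G b c d))))"
    by (subst (2) sum.swap, subst sum.swap) (rule refl)
  also have "\<dots> = (\<Sum>b\<in>UNIV. \<Sum>r\<in>UNIV. \<Sum>c\<in>UNIV. (\<Sum>d\<in>UNIV. g$r$d * F b c d) * (\<Sum>d\<in>UNIV. g$r$d * G b c d))"
    by (subst orthogonal_contract2[OF assms], subst sum.swap) (rule refl)
  also have "\<dots> = (\<Sum>b\<in>UNIV. \<Sum>c\<in>UNIV. \<Sum>d\<in>UNIV. F b c d * G b c d)"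
    by (subst sum.swap, subst orthogonal_contract[OF assms]) (rule refl)
  finally show ?thesis .
qed

section \<open>The rotation action on second-order tensors\<close>

lemma act2_add: "act2 g (a + b) = act2 g a + act2 g b"
  by (simp add: vec_eq_iff act2_nth sum.distrib distrib_left)

lemma act2_diff: "act2 g (a - b) = act2 g a - act2 g b"
  by (simp add: vec_eq_iff act2_nth sum_subtractf right_diff_distrib)

lemma act2_scaleR: "act2 g (c *\<^sub>R a) = c *\<^sub>R act2 g a"
  by (simp add: vec_eq_iff act2_nth sum_distrib_left mult_ac)

lemma act2_mat_1: "orthogonal_matrix g \<Longrightarrow> act2 g (mat 1) = mat 1"
  by (simp add: act2_def orthogonal_matrix_def)

lemma act2_mult: "orthogonal_matrix g \<Longrightarrow> act2 g (a ** b) = act2 g a ** act2 g b"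
proof -
  assume g: "orthogonal_matrix g"
  have "act2 g a ** act2 g b = g ** a ** (transpose g ** g) ** b ** transpose g"
    by (simp add: act2_def matrix_mul_assoc)
  also have "\<dots> = act2 g (a ** b)"
    using g by (simp only: act2_def orthogonal_matrix_def matrix_mul_assoc matrix_mul_rid)
  finally show ?thesis ..
qed

lemma trace_act2: "orthogonal_matrix g \<Longrightarrow> trace (act2 g a) = trace a"
  unfolding act2_def
  by (subst trace_mul_sym) (simp add: matrix_mul_assoc orthogonal_matrix_def)

lemma inner_act2:
  assumes "orthogonal_matrix g"
  shows "act2 g a \<bullet> act2 g b = a \<bullet> b"
proof -
  have n: "act2 g c $ i $ j = (\<Sum>p\<in>UNIV. g$i$p * (\<Sum>q\<in>UNIV. g$j$q * c$p$q))" for c i j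
    by (simp add: act2_nth sum_distrib_left mult.assoc)
  show ?thesis
    by (simp add: inner_vec_def n orthogonal_contract2[OF assms])
qed

lemma norm_act2: "orthogonal_matrix g \<Longrightarrow> norm (act2 g a) = norm a"
  by (simp add: norm_eq_sqrt_inner inner_act2)

lemma deviator_act2: "orthogonal_matrix g \<Longrightarrow> deviator (act2 g a) = act2 g (deviator a)"
  by (simp add: deviator_def act2_diff act2_scaleR act2_mat_1 trace_act2)

section \<open>The rotation action on fourth-order tensors and the equivariance of the covariants\<close>

lemma act4_add: "act4 g (T + S) = act4 g T + act4 g S"
  by (simp add: vec_eq_iff act4_def sum.distrib distrib_left)

lemma act4_diff: "act4 g (T - S) = act4 g T - act4 g S"
  by (simp add: vec_eq_iff act4_def sum_subtractf right_diff_distrib)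

lemma act4_scaleR: "act4 g (c *\<^sub>R T) = c *\<^sub>R act4 g T"
  by (simp add: vec_eq_iff act4_def sum_distrib_left mult_ac)

lemma act4_mat_1: "act4 (mat 1) T = T"
  by (simp add: vec_eq_iff act4_nested mat_def if_distrib [where f = "\<lambda>x. x * _"] cong: if_cong)

lemma sum_mult_commute:
  fixes u v :: "3 \<Rightarrow> real"
  shows "(\<Sum>p\<in>UNIV. u p * (\<Sum>q\<in>UNIV. v q * Y p q)) = (\<Sum>q\<in>UNIV. v q * (\<Sum>p\<in>UNIV. u p * Y p q))"
  by (simp add: sum_distrib_left, subst sum.swap, simp add: mult_ac)

lemma act4_mult: "act4 (g ** h) T = act4 g (act4 h T)"
proof -
  have mm: "(\<Sum>p\<in>UNIV. (g ** h)$i$p * X p) = (\<Sum>a\<in>UNIV. g$i$a * (\<Sum>p\<in>UNIV. h$a$p * X p))" for i X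
    by (simp add: matrix_matrix_mult_def sum_distrib_left sum_distrib_right mult_ac, subst sum.swap)
      (rule refl)
  have c: "(\<Sum>q\<in>UNIV. h$b$q * (\<Sum>c\<in>UNIV. g$k$c * Y q c)) = (\<Sum>c\<in>UNIV. g$k$c * (\<Sum>q\<in>UNIV. h$b$q * Y q c))"
    for b k Y
    by (rule sum_mult_commute)
  show ?thesis
    unfolding vec_eq_iff
    by (simp only: act4_nested mm c simp_thms)
qed

text \<open>
  The transpositions of adjacent index positions. They generate all index permutations, and each
  of them commutes with the action; this gives the equivariance of the total symmetrization and
  the invariance of \<^const>\<open>Ela\<close>.
\<close>
definition swap01 :: "tensor4 \<Rightarrow> tensor4" where "swap01 T = (\<chi> i j k l. T$j$i$k$l)"
definition swap12 :: "tensor4 \<Rightarrow> tensor4" where "swap12 T = (\<chi> i j k l. T$i$k$j$l)"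
definition swap23 :: "tensor4 \<Rightarrow> tensor4" where "swap23 T = (\<chi> i j k l. T$i$j$l$k)"

lemma act4_swap01: "act4 g (swap01 T) = swap01 (act4 g T)"
  unfolding vec_eq_iff swap01_def act4_def
  by (simp, intro allI, subst sum.swap, simp add: mult_ac)
lemma act4_swap12: "act4 g (swap12 T) = swap12 (act4 g T)"
  unfolding vec_eq_iff swap12_def act4_def
  by (simp, intro allI, subst (2) sum.swap, simp add: mult_ac)
lemma act4_swap23: "act4 g (swap23 T) = swap23 (act4 g T)"
  unfolding vec_eq_iff swap23_def act4_def
  by (simp, intro allI, subst (3) sum.swap, simp add: mult_ac)

lemma total_sym_nth:
  "total_sym T $ i $ j $ k $ l = (1/24) * (
      T$i$j$k$l + T$i$j$l$k + T$i$k$j$l + T$i$k$l$j + T$i$l$j$k + T$i$l$k$j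
    + T$j$i$k$l + T$j$i$l$k + T$j$k$i$l + T$j$k$l$i + T$j$l$i$k + T$j$l$k$i
    + T$k$i$j$l + T$k$i$l$j + T$k$j$i$l + T$k$j$l$i + T$k$l$i$j + T$k$l$j$i
    + T$l$i$j$k + T$l$i$k$j + T$l$j$i$k + T$l$j$k$i + T$l$k$i$j + T$l$k$j$i)"
proof -
  have e: "{..<4::nat} = insert 0 (insert 1 (insert 2 (insert 3 {})))" by auto
  show ?thesis
    unfolding total_sym_def e Let_def
    by ((subst sum_over_permutations_insert, simp, simp)+)
      (simp add: permutes_sing transpose_def fact_numeral)
qed

text \<open>
  The sum over the symmetric group of the four positions, factored along the chain of subgroups
  permuting the first two, three and four positions: each step multiplies by coset
  representatives that are products of adjacent transpositions.
\<close>
lemma total_sym_alt: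
  "total_sym T = (1/24) *\<^sub>R (let T1 = T + swap01 T; T2 = T1 + swap12 T1 + swap01 (swap12 T1)
     in T2 + swap23 T2 + swap12 (swap23 T2) + swap01 (swap12 (swap23 T2)))"
  by (simp add: vec_eq_iff total_sym_nth Let_def swap01_def swap12_def swap23_def)

lemma total_sym_act4: "total_sym (act4 g T) = act4 g (total_sym T)"
  by (simp add: total_sym_alt Let_def act4_add act4_scaleR act4_swap01 act4_swap12 act4_swap23)

lemma tensor_prod_act2: "tensor_prod (act2 g a) (act2 g b) = act4 g (tensor_prod a b)"
  unfolding vec_eq_iff tensor_prod_def act4_def
  apply (simp only: vec_lambda_beta act2_nth)
  \<comment> \<open>One factor at a time, so that both sides nest their sums in the same order.\<close>
  unfolding sum_distrib_right
  unfolding sum_distrib_left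
  by (simp add: mult_ac)

lemma sym_prod_act2: "sym_prod (act2 g a) (act2 g b) = act4 g (sym_prod a b)"
  by (simp add: sym_prod_def tensor_prod_act2 total_sym_act4)

lemma Ela_iff: "E \<in> Ela \<longleftrightarrow> swap01 E = E \<and> swap12 (swap01 (swap23 (swap12 E))) = E"
  unfolding Ela_def swap01_def swap12_def swap23_def vec_eq_iff
  by simp metis

lemma act4_Ela: "E \<in> Ela \<Longrightarrow> act4 g E \<in> Ela"
  by (simp add: Ela_iff act4_swap01[symmetric] act4_swap12[symmetric] act4_swap23[symmetric])

lemma ela_d_act4:
  assumes "orthogonal_matrix g"
  shows "ela_d (act4 g E) = act2 g (ela_d E)"
proof -
  have tr: "(\<Sum>k\<in>UNIV. \<Sum>p\<in>UNIV. g$k$p * (\<Sum>q\<in>UNIV. g$k$q * Z p q)) = (\<Sum>p\<in>UNIV. Z p p)" for Z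
    using trace_act2[OF assms, of "\<chi> p q. Z p q"]
    by (simp add: trace_def act2_nth sum_distrib_left mult.assoc)
  have "(\<Sum>k\<in>UNIV. act4 g E $k$k$i$j) = (\<Sum>r\<in>UNIV. g$i$r * (\<Sum>s\<in>UNIV. g$j$s * (\<Sum>p\<in>UNIV. E$p$p$r$s)))" for i j
    unfolding act4_nested tr
    by (simp add: sum_distrib_left, subst sum.swap, subst (2) sum.swap, rule refl)
  then show ?thesis
    by (simp add: vec_eq_iff ela_d_def act2_nth sum_distrib_left mult.assoc)
qed

lemma ela_v_eq: "ela_v E = ela_d (swap12 E)"
  by (simp add: vec_eq_iff ela_v_def ela_d_def swap12_def)

lemma ela_v_act4: "orthogonal_matrix g \<Longrightarrow> ela_v (act4 g E) = act2 g (ela_v E)"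
  by (simp add: ela_v_eq act4_swap12[symmetric] ela_d_act4)

lemma ela_a_act4: "orthogonal_matrix g \<Longrightarrow> ela_a (act4 g E) = act2 g (ela_a E)"
  by (simp add: ela_a_def ela_d_act4 ela_v_act4 act2_add act2_scaleR)

lemma ela_H_act4: "orthogonal_matrix g \<Longrightarrow> ela_H (act4 g E) = act4 g (ela_H E)"
  using sym_prod_act2[of g "mat 1" "mat 1"] sym_prod_act2[of g "mat 1" "deviator (ela_a E)"]
  by (simp add: ela_H_def ela_a_act4 total_sym_act4 act4_diff act4_scaleR deviator_act2 act2_mat_1 trace_act2)

lemma contract4_act:
  assumes "orthogonal_matrix g"
  shows "contract4 (act2 g a) (act4 g H) (act2 g b) = contract4 a H b"
proof -
  define hc :: "tensor2 \<Rightarrow> tensor4 \<Rightarrow> tensor2"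
    where "hc a H = (\<chi> k l. \<Sum>i\<in>UNIV. \<Sum>j\<in>UNIV. a$i$j * H$i$j$k$l)" for a H
  have inner: "contract4 a H b = hc a H \<bullet> b" for a H b
  proof -
    have "contract4 a H b = (\<Sum>k\<in>UNIV. \<Sum>i\<in>UNIV. \<Sum>j\<in>UNIV. \<Sum>l\<in>UNIV. a$i$j * H$i$j$k$l * b$k$l)"
      unfolding contract4_def by (subst (2) sum.swap, subst sum.swap) (rule refl)
    also have "\<dots> = (\<Sum>k\<in>UNIV. \<Sum>l\<in>UNIV. \<Sum>i\<in>UNIV. \<Sum>j\<in>UNIV. a$i$j * H$i$j$k$l * b$k$l)"
      by (subst (3) sum.swap, subst (2) sum.swap) (rule refl)
    finally show ?thesis
      by (simp add: inner_vec_def hc_def sum_distrib_right)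
  qed
  have "hc (act2 g a) (act4 g H) $ k $ l = act2 g (hc a H) $ k $ l" for k l
  proof -
    have a: "act2 g a $ i $ j = (\<Sum>p\<in>UNIV. g$i$p * (\<Sum>q\<in>UNIV. g$j$q * a$p$q))" for i j
      by (simp add: act2_nth sum_distrib_left mult.assoc)
    have "hc (act2 g a) (act4 g H) $ k $ l
        = (\<Sum>p\<in>UNIV. \<Sum>q\<in>UNIV. a$p$q * (\<Sum>r\<in>UNIV. g$k$r * (\<Sum>s\<in>UNIV. g$l$s * H$p$q$r$s)))"
      by (simp add: hc_def a act4_nested orthogonal_contract2[OF assms])
    also have "\<dots> = (\<Sum>r\<in>UNIV. \<Sum>p\<in>UNIV. \<Sum>q\<in>UNIV. \<Sum>s\<in>UNIV. a$p$q * (g$k$r * (g$l$s * H$p$q$r$s)))"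
      unfolding sum_distrib_left by (subst (2) sum.swap, subst sum.swap) (rule refl)
    also have "\<dots> = (\<Sum>r\<in>UNIV. \<Sum>s\<in>UNIV. \<Sum>p\<in>UNIV. \<Sum>q\<in>UNIV. a$p$q * (g$k$r * (g$l$s * H$p$q$r$s)))"
      by (subst (3) sum.swap, subst (2) sum.swap) (rule refl)
    also have "\<dots> = act2 g (hc a H) $ k $ l"
      by (simp add: act2_nth hc_def sum_distrib_left mult_ac)
    finally show ?thesis .
  qed
  then have "hc (act2 g a) (act4 g H) = act2 g (hc a H)"
    by (simp add: vec_eq_iff)
  then show ?thesis by (simp add: inner inner_act2[OF assms])
qed

lemma ela_d2_act4:
  assumes "orthogonal_matrix g"
  shows "ela_d2 (act4 g E) = act2 g (ela_d2 E)"
proof -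
  define H where "H = ela_H E"
  define F where "F i b c d = (\<Sum>a\<in>UNIV. g$i$a * H$a$b$c$d)" for i b c d
  define G where "G j b c d = (\<Sum>e\<in>UNIV. g$j$e * H$b$c$d$e)" for j b c d
  have 1: "act4 g H $ i $ p $ q $ r = (\<Sum>b\<in>UNIV. g$p$b * (\<Sum>c\<in>UNIV. g$q$c * (\<Sum>d\<in>UNIV. g$r$d * F i b c d)))"
    for i p q r
    unfolding act4_nested F_def
    by (simp only: sum_mult_commute[where u = "\<lambda>a. g$i$a"])
  have 2: "act4 g H $ p $ q $ r $ j = (\<Sum>b\<in>UNIV. g$p$b * (\<Sum>c\<in>UNIV. g$q$c * (\<Sum>d\<in>UNIV. g$r$d * G j b c d)))"
    for p q r j
    by (simp add: act4_nested G_def)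
  have 3: "(\<Sum>b\<in>UNIV. \<Sum>c\<in>UNIV. \<Sum>d\<in>UNIV. (\<Sum>a\<in>UNIV. g$i$a * H$a$b$c$d) * (\<Sum>e\<in>UNIV. g$j$e * H$b$c$d$e))
     = (\<Sum>p\<in>UNIV. \<Sum>q\<in>UNIV. g$i$p * g$j$q * (\<Sum>b\<in>UNIV. \<Sum>c\<in>UNIV. \<Sum>d\<in>UNIV. H$p$b$c$d * H$b$c$d$q))"
    (is "?L = ?R") for i j
  proof -
    have rot: "(\<Sum>d\<in>UNIV. \<Sum>p\<in>UNIV. \<Sum>q\<in>UNIV. f d p q) = (\<Sum>p\<in>UNIV. \<Sum>q\<in>UNIV. \<Sum>d\<in>UNIV. f d p q)"
      for f :: "3 \<Rightarrow> 3 \<Rightarrow> 3 \<Rightarrow> real"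
      by (subst sum.swap, subst (2) sum.swap) (rule refl)
    have "?L = (\<Sum>b\<in>UNIV. \<Sum>c\<in>UNIV. \<Sum>d\<in>UNIV. \<Sum>p\<in>UNIV. \<Sum>q\<in>UNIV. g$i$p * H$p$b$c$d * (g$j$q * H$b$c$d$q))"
      by (simp only: sum_product)
    also have "\<dots> = (\<Sum>b\<in>UNIV. \<Sum>c\<in>UNIV. \<Sum>p\<in>UNIV. \<Sum>q\<in>UNIV. \<Sum>d\<in>UNIV. g$i$p * H$p$b$c$d * (g$j$q * H$b$c$d$q))"
      by (rule sum.cong[OF refl], rule sum.cong[OF refl], rule rot)
    also have "\<dots> = (\<Sum>b\<in>UNIV. \<Sum>p\<in>UNIV. \<Sum>q\<in>UNIV. \<Sum>c\<in>UNIV. \<Sum>d\<in>UNIV. g$i$p * H$p$b$c$d * (g$j$q * H$b$c$d$q))"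
      by (rule sum.cong[OF refl], rule rot)
    also have "\<dots> = (\<Sum>p\<in>UNIV. \<Sum>q\<in>UNIV. \<Sum>b\<in>UNIV. \<Sum>c\<in>UNIV. \<Sum>d\<in>UNIV. g$i$p * H$p$b$c$d * (g$j$q * H$b$c$d$q))"
      by (rule rot)
    also have "\<dots> = ?R"
      by (simp add: sum_distrib_left mult_ac)
    finally show ?thesis .
  qed
  have "(\<Sum>p\<in>UNIV. \<Sum>q\<in>UNIV. \<Sum>r\<in>UNIV. act4 g H $i$p$q$r * act4 g H $p$q$r$j)
     = (\<Sum>p\<in>UNIV. \<Sum>q\<in>UNIV. g$i$p * g$j$q * (\<Sum>b\<in>UNIV. \<Sum>c\<in>UNIV. \<Sum>d\<in>UNIV. H$p$b$c$d * H$b$c$d$q))" for i j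
    unfolding 1[of i] 2[of _ _ _ j] orthogonal_contract3[OF assms] unfolding F_def G_def by (rule 3)
  then show ?thesis
    by (simp add: vec_eq_iff ela_d2_def Let_def ela_H_act4[OF assms] H_def[symmetric] act2_nth)
qed

lemma ela_t_act4: "orthogonal_matrix g \<Longrightarrow> ela_t (act4 g E) = act2 g (ela_t E)"
  by (simp add: ela_t_def Let_def ela_d_act4 ela_v_act4 ela_d2_act4 deviator_act2 norm_act2
     act2_mult[symmetric] act2_add[symmetric] act2_scaleR[symmetric])

section \<open>Trigonal tensors in normal position\<close>

text \<open>
  The elasticity tensor with Voigt matrix of trigonal type, where \<open>e\<^sub>3\<close> is the threefold and \<open>e\<^sub>1\<close> a
  twofold axis. The parameters are the usual elastic constants: \<open>c14\<close> is the component \<open>E\<^sub>1\<^sub>1\<^sub>2\<^sub>3\<close>,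
  and \<open>c66 = (c11 - c12) / 2\<close> is dependent. The outer two levels of the nested vector give \<open>i\<close> and
  \<open>j\<close>, the inner two \<open>k\<close> and \<open>l\<close>.
\<close>
definition trig :: "real \<Rightarrow> real \<Rightarrow> real \<Rightarrow> real \<Rightarrow> real \<Rightarrow> real \<Rightarrow> tensor4" where
  "trig c11 c33 c12 c13 c44 c14 = (let c66 = (c11 - c12) / 2 in
     vector [
       vector [vector [vector [c11, 0, 0], vector [0, c12, c14], vector [0, c14, c13]],
               vector [vector [0, c66, c14], vector [c66, 0, 0], vector [c14, 0, 0]],
               vector [vector [0, c14, c44], vector [c14, 0, 0], vector [c44, 0, 0]]],
       vector [vector [vector [0, c66, c14], vector [c66, 0, 0], vector [c14, 0, 0]],
               vector [vector [c12, 0, 0], vector [0, c11, - c14], vector [0, - c14, c13]],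
               vector [vector [c14, 0, 0], vector [0, - c14, c44], vector [0, c44, 0]]],
       vector [vector [vector [0, c14, c44], vector [c14, 0, 0], vector [c44, 0, 0]],
               vector [vector [c14, 0, 0], vector [0, - c14, c44], vector [0, c44, 0]],
               vector [vector [c13, 0, 0], vector [0, c13, 0], vector [0, 0, c33]]]])"

text \<open>
  The diagonal tensor with entries \<open>x, x, y\<close>, the general symmetric second-order tensor of axial
  symmetry about \<open>e\<^sub>3\<close>.
\<close>
definition diag3 :: "real \<Rightarrow> real \<Rightarrow> tensor2" where
  "diag3 x y = vector [vector [x, 0, 0], vector [0, x, 0], vector [0, 0, y]]"

text \<open>
  The trigonal harmonic tensors: \<open>h\<close> is the component \<open>H\<^sub>3\<^sub>3\<^sub>3\<^sub>3\<close> of the part that is axially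
  symmetric about \<open>e\<^sub>3\<close>, and \<open>s = H\<^sub>1\<^sub>1\<^sub>2\<^sub>3\<close> measures the threefold part.
\<close>
definition harm :: "real \<Rightarrow> real \<Rightarrow> tensor4" where
  "harm h s = trig (3*h/8) h (h/8) (- h/2) (- h/2) s"

text \<open>
  The 21 independent components of an elasticity tensor determine it.
\<close>
lemma Ela_ext:
  assumes E: "E \<in> Ela" and F: "F \<in> Ela"
    and eq: "E$1$1$1$1 = F$1$1$1$1" "E$1$1$2$2 = F$1$1$2$2" "E$1$1$3$3 = F$1$1$3$3"
      "E$1$1$2$3 = F$1$1$2$3" "E$1$1$1$3 = F$1$1$1$3" "E$1$1$1$2 = F$1$1$1$2"
      "E$2$2$2$2 = F$2$2$2$2" "E$2$2$3$3 = F$2$2$3$3"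
      "E$2$2$2$3 = F$2$2$2$3" "E$2$2$1$3 = F$2$2$1$3" "E$2$2$1$2 = F$2$2$1$2"
      "E$3$3$3$3 = F$3$3$3$3"
      "E$3$3$2$3 = F$3$3$2$3" "E$3$3$1$3 = F$3$3$1$3" "E$3$3$1$2 = F$3$3$1$2"
      "E$2$3$2$3 = F$2$3$2$3" "E$2$3$1$3 = F$2$3$1$3" "E$2$3$1$2 = F$2$3$1$2"
      "E$1$3$1$3 = F$1$3$1$3" "E$1$3$1$2 = F$1$3$1$2" "E$1$2$1$2 = F$1$2$1$2"
  shows "E = F"
proof -
  have 1: "T$i$j$k$l = T$k$l$i$j" "T$i$j$k$l = T$j$i$k$l" if "T \<in> Ela" for T i j k l
    using that unfolding Ela_def by blast+
  define P where "P i j k l \<longleftrightarrow> E$i$j$k$l = F$i$j$k$l" for i j k l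
  have s: "P k l i j = P i j k l" "P j i k l = P i j k l" for i j k l
    using 1[OF E] 1[OF F] by (simp_all add: P_def)
  have base: "P 1 1 1 1" "P 1 1 2 2" "P 1 1 3 3" "P 1 1 2 3" "P 1 1 1 3" "P 1 1 1 2"
    "P 2 2 2 2" "P 2 2 3 3" "P 2 2 2 3" "P 2 2 1 3" "P 2 2 1 2" "P 3 3 3 3" "P 3 3 2 3" "P 3 3 1 3" "P 3 3 1 2"
    "P 2 3 2 3" "P 2 3 1 3" "P 2 3 1 2" "P 1 3 1 3" "P 1 3 1 2" "P 1 2 1 2"
    using eq by (simp_all add: P_def)
  have "\<forall>i j k l. P i j k l"
    unfolding forall_3 using base s by metis
  then show ?thesis by (simp add: vec_eq_iff P_def)
qed

lemma trig_Ela: "trig c11 c33 c12 c13 c44 c14 \<in> Ela"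
  unfolding Ela_def trig_def Let_def by (simp add: forall_3)

lemma total_sym_Ela:
  assumes "E \<in> Ela"
  shows "total_sym E $ i $ j $ k $ l = (E$i$j$k$l + E$i$k$j$l + E$i$l$j$k) / 3"
proof -
  have s: "E$i$j$k$l = E$k$l$i$j" "E$i$j$k$l = E$j$i$k$l" for i j k l
    using assms unfolding Ela_def by blast+
  have "E$i$j$k$l = E$i$j$l$k" for i j k l
    using s by metis
  with s show ?thesis by (simp add: total_sym_nth)
qed

lemma sym_prod_nth:
  assumes "transpose a = a" "transpose b = b"
  shows "sym_prod a b $ i $ j $ k $ l = (a$i$j * b$k$l + a$k$l * b$i$j + a$i$k * b$j$l
    + a$j$l * b$i$k + a$i$l * b$j$k + a$j$k * b$i$l) / 6"
proof -
  have s: "a$i$j = a$j$i" "b$i$j = b$j$i" for i j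
    using assms by (simp_all add: vec_eq_iff transpose_def)
  show ?thesis 
    unfolding sym_prod_def total_sym_nth tensor_prod_def
    by (simp add: s[of l] s[of k j] s[of k i] s[of j i])
qed

lemma d_trig: "ela_d (trig c11 c33 c12 c13 c44 c14) = diag3 (c11 + c12 + c13) (2 * c13 + c33)"
  by (simp add: vec_eq_iff forall_3 ela_d_def trig_def Let_def diag3_def sum_3)

lemma v_trig: "ela_v (trig c11 c33 c12 c13 c44 c14) = diag3 (c11 + (c11 - c12) / 2 + c44) (2 * c44 + c33)"
  by (simp add: vec_eq_iff forall_3 ela_v_def trig_def Let_def diag3_def sum_3)

lemma transpose_diag3: "transpose (diag3 x y) = diag3 x y"
  by (simp add: vec_eq_iff forall_3 transpose_def diag3_def)
lemma mat1_diag3: "mat 1 = diag3 1 1"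
  by (simp add: vec_eq_iff forall_3 mat_def diag3_def)
lemma add_diag3: "diag3 x y + diag3 x' y' = diag3 (x + x') (y + y')"
  by (simp add: vec_eq_iff forall_3 diag3_def)
lemma diff_diag3: "diag3 x y - diag3 x' y' = diag3 (x - x') (y - y')"
  by (simp add: vec_eq_iff forall_3 diag3_def)
lemma scaleR_diag3: "c *\<^sub>R diag3 x y = diag3 (c * x) (c * y)"
  by (simp add: vec_eq_iff forall_3 diag3_def)
lemma mult_diag3: "diag3 x y ** diag3 x' y' = diag3 (x * x') (y * y')"
  by (simp add: vec_eq_iff forall_3 diag3_def matrix_matrix_mult_def sum_3)
lemma trace_diag3: "trace (diag3 x y) = 2 * x + y"
  by (simp add: trace_def sum_3 diag3_def)
lemma inner_diag3: "diag3 x y \<bullet> diag3 x' y' = 2 * x * x' + y * y'"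
  by (simp add: inner_vec_def sum_3 diag3_def)
lemma norm_diag3: "(norm (diag3 x y))\<^sup>2 = 2 * x\<^sup>2 + y\<^sup>2"
  unfolding power2_norm_eq_inner inner_diag3 by (simp add: power2_eq_square)
lemma deviator_diag3: "deviator (diag3 x y) = diag3 (- (y - x) / 3) (2 * (y - x) / 3)"
  by (simp add: deviator_def mat1_diag3 trace_diag3 scaleR_diag3 diff_diag3 field_simps)

lemmas diag3_simps = add_diag3 diff_diag3 scaleR_diag3 mult_diag3 trace_diag3 inner_diag3 deviator_diag3

lemma H_trig: "ela_H (trig c11 c33 c12 c13 c44 c14) = harm (8/35 * (c11 + c33 - 2 * c13 - 4 * c44)) c14"
proof -
  let ?T = "trig c11 c33 c12 c13 c44 c14"
  define a where "a = ela_a ?T"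
  have a: "a = diag3 (2/7 * (c11 + c12 + c13 + 2 * (c11 + (c11 - c12) / 2 + c44)))
     (2/7 * (2 * c13 + c33 + 2 * (2 * c44 + c33)))"
    unfolding a_def ela_a_def d_trig v_trig diag3_simps ..
  show ?thesis
    unfolding ela_H_def a_def[symmetric] unfolding a diag3_simps mat1_diag3
    unfolding vec_eq_iff vector_minus_component vector_scaleR_component total_sym_Ela[OF trig_Ela]
      sym_prod_nth[OF transpose_diag3 transpose_diag3]
    by (simp add: forall_3 harm_def trig_def Let_def diag3_def field_simps)
qed

lemma d2_trig:
  assumes "h = 8/35 * (c11 + c33 - 2 * c13 - 4 * c44)"
  shows "ela_d2 (trig c11 c33 c12 c13 c44 c14) = diag3 (15/16 * h\<^sup>2 + 6 * c14\<^sup>2) (5/2 * h\<^sup>2 + 4 * c14\<^sup>2)"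
  unfolding ela_d2_def Let_def H_trig assms[symmetric]
  by (simp add: vec_eq_iff forall_3 harm_def trig_def Let_def diag3_def sum_3 power2_eq_square field_simps)

lemma I2_trig:
  assumes "h = 8/35 * (c11 + c33 - 2 * c13 - 4 * c44)"
  shows "ela_I2 (trig c11 c33 c12 c13 c44 c14) = 35/8 * h\<^sup>2 + 16 * c14\<^sup>2"
  unfolding ela_I2_def d2_trig[OF assms] trace_diag3 by simp

text \<open>
  The deviator of \<open>e\<^sub>3 \<otimes> e\<^sub>3\<close>, which will be the value of \<open>t\<close>: it only remembers the threefold axis.
\<close>
definition axial :: tensor2 where "axial = diag3 (- 1/3) (2/3)"

text \<open>
  The deviators of \<open>d\<close>, \<open>v\<close> and \<open>d\<^sub>2\<close> are multiples of \<^const>\<open>axial\<close>, and the deviator of the square of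
  \<^const>\<open>axial\<close> is a third of \<^const>\<open>axial\<close>. The weights and exponents in \<open>t\<close> make its numerator a nonnegative
  multiple of \<^const>\<open>axial\<close> that is proportional to the denominator, so the signs and sizes of the
  three deviators cancel. The second hypothesis says that one of the three deviators is nonzero.
\<close>
lemma t_trig:
  assumes h: "h = 8/35 * (c11 + c33 - 2 * c13 - 4 * c44)"
    and nz: "c11 + c12 \<noteq> c13 + c33 \<or> c11 + (c11 - c12) / 2 \<noteq> c44 + c33 \<or> 25 * h\<^sup>2 \<noteq> 32 * c14\<^sup>2"
  shows "ela_t (trig c11 c33 c12 c13 c44 c14) = axial"
proof -
  define x where "x = c13 + c33 - (c11 + c12)"
  define y where "y = c44 + c33 - (c11 + (c11 - c12) / 2)"
  define z where "z = 25/16 * h\<^sup>2 - 2 * c14\<^sup>2"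
  have nz: "x \<noteq> 0 \<or> y \<noteq> 0 \<or> z \<noteq> 0" using nz by (auto simp: x_def y_def z_def)
  let ?T = "trig c11 c33 c12 c13 c44 c14"
  have d: "deviator (ela_d ?T) = diag3 (- x/3) (2*x/3)"
    unfolding d_trig deviator_diag3 x_def by (simp add: algebra_simps)
  have v: "deviator (ela_v ?T) = diag3 (- y/3) (2*y/3)"
    unfolding v_trig deviator_diag3 y_def by (simp add: algebra_simps)
  have d2: "deviator (ela_d2 ?T) = diag3 (- z/3) (2*z/3)"
    unfolding d2_trig[OF h] deviator_diag3 z_def by (simp add: algebra_simps)
  have n: "norm (diag3 (- w/3) (2*w/3)) ^ 2 = 2/3 * w^2" for w
    unfolding norm_diag3 by (simp add: power2_eq_square)
  have n4: "norm (diag3 (- w/3) (2*w/3)) ^ 4 = 4/9 * w^4" for w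
  proof -
    have "norm (diag3 (- w/3) (2*w/3)) ^ 4 = (norm (diag3 (- w/3) (2*w/3)) ^ 2)^2" by simp
    then show ?thesis unfolding n by (simp add: power2_eq_square power4_eq_xxxx)
  qed
  have N: "4/9 * x^4 + 4/9 * y^4 + 2/3 * z^2 \<noteq> 0"
  proof
    have "0 \<le> x^4" "0 \<le> y^4" "0 \<le> z^2" by simp_all
    moreover assume "4/9 * x^4 + 4/9 * y^4 + 2/3 * z^2 = 0"
    ultimately have "x^4 = 0 \<and> y^4 = 0 \<and> z^2 = 0" by linarith
    then show False using nz by simp
  qed
  define N where "N = 4/9 * x^4 + 4/9 * y^4 + 2/3 * z^2"
  have dev: "deviator ((2/3 * x^2) *\<^sub>R (diag3 (- x/3) (2*x/3) ** diag3 (- x/3) (2*x/3))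
      + (2/3 * y^2) *\<^sub>R (diag3 (- y/3) (2*y/3) ** diag3 (- y/3) (2*y/3))
      + diag3 (- z/3) (2*z/3) ** diag3 (- z/3) (2*z/3)) = diag3 (- N / 6) (N / 3)"
    unfolding N_def diag3_simps
    by (rule arg_cong2[where f = diag3]) (simp_all add: power2_eq_square power4_eq_xxxx field_simps)
  have "ela_t ?T = (2/N) *\<^sub>R diag3 (- N / 6) (N / 3)"
    unfolding ela_t_def Let_def d v d2 n n4 N_def[symmetric] dev ..
  also have "N \<noteq> 0" unfolding N_def by (rule N)
  then have "(2/N) *\<^sub>R diag3 (- N / 6) (N / 3) = axial" by (simp add: axial_def diag3_simps)
  finally show ?thesis .
qed

lemma contract4_axial: "contract4 axial (harm h s) axial = h"
  by (simp add: contract4_def axial_def harm_def trig_def Let_def diag3_def sum_3)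

section \<open>Symmetry groups and strata\<close>

lemma carrier_SO3: "g \<in> carrier SO3 \<longleftrightarrow> orthogonal_matrix g \<and> det g = 1"
  by (simp add: SO3_def rotation_matrix_def)

lemma mult_SO3: "g \<otimes>\<^bsub>SO3\<^esub> h = g ** h" and one_SO3: "\<one>\<^bsub>SO3\<^esub> = mat 1"
  by (simp_all add: SO3_def)

lemma inv_SO3: "g \<in> carrier SO3 \<Longrightarrow> inv\<^bsub>SO3\<^esub> g = transpose g"
  by (rule group.inv_equality[OF group_SO3])
    (simp_all add: SO3_def rotation_matrix_def orthogonal_matrix_def det_transpose)

lemma act4_inverse:
  assumes "g \<in> carrier SO3"
  shows "act4 (transpose g) (act4 g E) = E" "act4 g (act4 (transpose g) E) = E"
  using assms by (simp_all add: act4_mult[symmetric] carrier_SO3 orthogonal_matrix_def act4_mat_1)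

lemma transpose_SO3: "g \<in> carrier SO3 \<Longrightarrow> transpose g \<in> carrier SO3"
  by (simp add: carrier_SO3 det_transpose)

lemma mult_in_SO3: "g \<in> carrier SO3 \<Longrightarrow> h \<in> carrier SO3 \<Longrightarrow> g ** h \<in> carrier SO3"
  by (simp add: carrier_SO3 orthogonal_matrix_mul det_mul)

lemma subgroup_symmetry_group: "subgroup (symmetry_group E) SO3"
proof (rule group.subgroupI[OF group_SO3])
  show "symmetry_group E \<noteq> {}"
    using act4_mat_1[of E] group.is_monoid[OF group_SO3, THEN monoid.one_closed]
    by (auto simp: symmetry_group_def one_SO3)
next
  fix g assume g: "g \<in> symmetry_group E"
  then have "act4 (transpose g) E = E"
    using act4_inverse(1)[of g E] by (simp add: symmetry_group_def)
  with g show "inv\<^bsub>SO3\<^esub> g \<in> symmetry_group E"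
    by (auto simp: symmetry_group_def inv_SO3 transpose_SO3)
qed (auto simp: symmetry_group_def mult_SO3 act4_mult mult_in_SO3)

lemma symmetry_group_act4:
  assumes "g \<in> carrier SO3"
  shows "symmetry_group (act4 g E) = (\<lambda>k. g \<otimes>\<^bsub>SO3\<^esub> k \<otimes>\<^bsub>SO3\<^esub> inv\<^bsub>SO3\<^esub> g) ` symmetry_group E"
proof -
  have o: "transpose g ** g = mat 1" "g ** transpose g = mat 1"
    using assms by (simp_all add: carrier_SO3 orthogonal_matrix_def)
  show ?thesis
  proof (intro equalityI subsetI)
    fix h assume h: "h \<in> symmetry_group (act4 g E)"
    let ?k = "transpose g ** h ** g"
    have "?k \<in> symmetry_group E"
      using h assms by (simp add: symmetry_group_def act4_mult act4_inverse mult_in_SO3 transpose_SO3)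
    moreover have "g ** ?k ** transpose g = (g ** transpose g) ** h ** (g ** transpose g)"
      by (simp only: matrix_mul_assoc)
    then have "h = g \<otimes>\<^bsub>SO3\<^esub> ?k \<otimes>\<^bsub>SO3\<^esub> inv\<^bsub>SO3\<^esub> g"
      by (simp add: mult_SO3 inv_SO3[OF assms] o)
    ultimately show "h \<in> (\<lambda>k. g \<otimes>\<^bsub>SO3\<^esub> k \<otimes>\<^bsub>SO3\<^esub> inv\<^bsub>SO3\<^esub> g) ` symmetry_group E"
      by blast
  next
    fix h assume "h \<in> (\<lambda>k. g \<otimes>\<^bsub>SO3\<^esub> k \<otimes>\<^bsub>SO3\<^esub> inv\<^bsub>SO3\<^esub> g) ` symmetry_group E"
    then show "h \<in> symmetry_group (act4 g E)"
      using assms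
      by (auto simp: symmetry_group_def mult_SO3 inv_SO3 act4_mult act4_inverse mult_in_SO3 transpose_SO3)
  qed
qed

lemma stratum_stable: "SO3_stable (stratum K)"
proof -
  have "act4 g E \<in> stratum K" if g: "g \<in> carrier SO3" and E: "E \<in> stratum K" for g E
  proof -
    interpret G: group SO3 by (rule group_SO3)
    obtain h where h: "h \<in> carrier SO3" "symmetry_group E = (\<lambda>k. h \<otimes>\<^bsub>SO3\<^esub> k \<otimes>\<^bsub>SO3\<^esub> inv\<^bsub>SO3\<^esub> h) ` K"
      using E by (auto simp: stratum_def conjugate_in_SO3_def)
    have "symmetry_group (act4 g E) = (\<lambda>k. (g ** h) \<otimes>\<^bsub>SO3\<^esub> k \<otimes>\<^bsub>SO3\<^esub> inv\<^bsub>SO3\<^esub> (g ** h)) ` K"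
      using g h(1) unfolding symmetry_group_act4[OF g] h(2) image_image
      by (simp add: mult_SO3 inv_SO3 mult_in_SO3 matrix_transpose_mul matrix_mul_assoc)
    with E g h(1) show ?thesis
      unfolding stratum_def conjugate_in_SO3_def by (blast intro: act4_Ela mult_in_SO3)
  qed
  then show ?thesis by (simp add: SO3_stable_def)
qed

text \<open>
  Every tensor of a stratum is a rotated copy of one whose symmetry group is \<open>K\<close> itself.
\<close>
lemma stratum_representative:
  assumes E: "E \<in> stratum K" and K: "K \<subseteq> carrier SO3"
  obtains g E0 where "g \<in> carrier SO3" "E0 \<in> Ela" "symmetry_group E0 = K" "E = act4 g E0"
proof -
  obtain h where h: "h \<in> carrier SO3" "symmetry_group E = (\<lambda>k. h \<otimes>\<^bsub>SO3\<^esub> k \<otimes>\<^bsub>SO3\<^esub> inv\<^bsub>SO3\<^esub> h) ` K"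
    using E by (auto simp: stratum_def conjugate_in_SO3_def)
  have o: "transpose h ** h = mat 1" "h ** transpose h = mat 1"
    using h(1) by (simp_all add: carrier_SO3 orthogonal_matrix_def)
  have "symmetry_group (act4 (transpose h) E) = (\<lambda>k. (transpose h ** h) ** k ** (transpose h ** h)) ` K"
    unfolding symmetry_group_act4[OF transpose_SO3[OF h(1)]] h(2) image_image
    by (simp add: mult_SO3 inv_SO3 h(1) transpose_SO3 matrix_mul_assoc)
  then have "symmetry_group (act4 (transpose h) E) = K"
    by (simp add: o)
  with h(1) E show thesis
    by (intro that[of h "act4 (transpose h) E"]) (simp_all add: act4_inverse act4_Ela stratum_def)
qed

lemma in_stratum_self: "E \<in> Ela \<Longrightarrow> E \<in> stratum (symmetry_group E)"
proof -
  assume "E \<in> Ela"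
  moreover have "mat 1 \<in> carrier SO3" by (simp add: carrier_SO3 orthogonal_matrix_id)
  moreover have "symmetry_group E = (\<lambda>k. mat 1 \<otimes>\<^bsub>SO3\<^esub> k \<otimes>\<^bsub>SO3\<^esub> inv\<^bsub>SO3\<^esub> (mat 1)) ` symmetry_group E"
    by (simp add: mult_SO3 inv_SO3 \<open>mat 1 \<in> carrier SO3\<close> transpose_mat)
  ultimately show ?thesis
    unfolding stratum_def conjugate_in_SO3_def by blast
qed

section \<open>Tensors fixed by the trigonal group\<close>

text \<open>
  The matrices that preserve the line of \<open>e\<^sub>3\<close> and the plane orthogonal to it; all elements of \<^const>\<open>D3\<close>
  have this shape.
\<close>
definition block :: "real \<Rightarrow> real \<Rightarrow> real \<Rightarrow> real \<Rightarrow> real \<Rightarrow> real^3^3" where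
  "block a b c d e = vector [vector [a, b, 0], vector [c, d, 0], vector [0, 0, e]]"

lemma rot_120: "rot_e3 (2 * pi / 3) = block (-1/2) (- sqrt 3 / 2) (sqrt 3 / 2) (-1/2) 1"
  by (simp add: rot_e3_def block_def cos_120 sin_120)
lemma rot_e3_pi: "rot_e3 pi = block (-1) 0 0 (-1) 1"
  by (simp add: rot_e3_def block_def)
lemma rot_e1_pi: "rot_e1 pi = block 1 0 0 (-1) (-1)"
  by (simp add: rot_e1_def block_def)

lemma mult_block: "block a b c d e ** block a' b' c' d' e' =
   block (a*a' + b*c') (a*b' + b*d') (c*a' + d*c') (c*b' + d*d') (e*e')"
  by (simp add: vec_eq_iff forall_3 block_def matrix_matrix_mult_def sum_3)

lemma transpose_block: "transpose (block a b c d e) = block a c b d e"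
  by (simp add: vec_eq_iff forall_3 block_def transpose_def)

lemma mat1_block: "mat 1 = block 1 0 0 1 1"
  by (simp add: vec_eq_iff forall_3 mat_def block_def)

lemma det_block: "det (block a b c d e) = e * (a * d - b * c)"
  by (simp add: det_3 block_def algebra_simps)

lemma rot_e3_in_SO3: "rot_e3 \<theta> \<in> carrier SO3"
proof -
  have "rot_e3 \<theta> = block (cos \<theta>) (- sin \<theta>) (sin \<theta>) (cos \<theta>) 1"
    by (simp add: rot_e3_def block_def)
  then show ?thesis
    using sin_cos_squared_add3[of \<theta>]
    by (simp add: carrier_SO3 orthogonal_matrix transpose_block mult_block mat1_block det_block add.commute)
qed

lemma rot_e1_pi_in_SO3: "rot_e1 pi \<in> carrier SO3"
  by (simp add: rot_e1_pi carrier_SO3 orthogonal_matrix transpose_block mult_block mat1_block det_block)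

lemma D3_carrier: "D3 \<subseteq> carrier SO3"
  unfolding D3_def using rot_e3_in_SO3 rot_e1_pi_in_SO3 by (intro group.generate_incl[OF group_SO3]) simp

lemma D3_subset_symmetry_group:
  assumes "act4 (rot_e3 (2 * pi / 3)) E = E" "act4 (rot_e1 pi) E = E"
  shows "D3 \<subseteq> symmetry_group E"
  unfolding D3_def
  using assms rot_e3_in_SO3 rot_e1_pi_in_SO3
  by (intro group.generate_subgroup_incl[OF group_SO3 _ subgroup_symmetry_group])
     (simp add: symmetry_group_def)

lemma generators_D3: "rot_e3 (2 * pi / 3) \<in> D3" "rot_e1 pi \<in> D3"
  unfolding D3_def by (simp_all add: generate.incl)

lemma trig_rot_e3_120:
  "act4 (rot_e3 (2 * pi / 3)) (trig c11 c33 c12 c13 c44 c14) = trig c11 c33 c12 c13 c44 c14"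
proof -
  define w where "w = sqrt 3"
  have w: "w * w = 3" "w * (w * x) = 3 * x" for x by (simp_all add: w_def mult.assoc[symmetric])
  show ?thesis
    unfolding rot_120 w_def[symmetric]
    by (rule Ela_ext[OF act4_Ela[OF trig_Ela] trig_Ela])
      (simp_all add: act4_nested sum_3 block_def trig_def Let_def, simp_all add: field_simps w)
qed

lemma trig_rot_e1_pi:
  "act4 (rot_e1 pi) (trig c11 c33 c12 c13 c44 c14) = trig c11 c33 c12 c13 c44 c14"
  unfolding rot_e1_pi
  by (rule Ela_ext[OF act4_Ela[OF trig_Ela] trig_Ela];
      simp add: act4_nested sum_3 block_def trig_def Let_def)

text \<open>
  This rotation normalizes \<^const>\<open>D3\<close> without belonging to it. It identifies the two signs of \<open>c14\<close>,
  which is why an invariant can only see \<open>c14\<^sup>2\<close>.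
\<close>
lemma trig_rot_e3_pi:
  "act4 (rot_e3 pi) (trig c11 c33 c12 c13 c44 c14) = trig c11 c33 c12 c13 c44 (- c14)"
  unfolding rot_e3_pi
  by (rule Ela_ext[OF act4_Ela[OF trig_Ela] trig_Ela];
      simp add: act4_nested sum_3 block_def trig_def Let_def field_simps)

text \<open>
  The twofold rotation kills the eight components with an odd number of indices different from
  1, and the threefold rotation then gives linear relations between the remaining thirteen.
\<close>
lemma D3_fixed_imp_trig:
  assumes E: "E \<in> Ela" and r3: "act4 (rot_e3 (2 * pi / 3)) E = E" and r1: "act4 (rot_e1 pi) E = E"
  shows "E = trig (E$1$1$1$1) (E$3$3$3$3) (E$1$1$2$2) (E$1$1$3$3) (E$2$3$2$3) (E$1$1$2$3)"
proof -
  have s: "E$i$j$k$l = E$k$l$i$j" "E$i$j$k$l = E$j$i$k$l" for i j k l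
    using E unfolding Ela_def by blast+
  have s': "E$i$j$k$l = E$i$j$l$k" for i j k l
    using s by metis
  have r1: "act4 (rot_e1 pi) E $i$j$k$l = E$i$j$k$l" for i j k l using r1 by simp
  have z: "E$1$1$1$3 = 0" "E$1$1$1$2 = 0" "E$2$2$1$3 = 0" "E$2$2$1$2 = 0" "E$3$3$1$3 = 0" "E$3$3$1$2 = 0"
     "E$2$3$1$3 = 0" "E$2$3$1$2 = 0"
    using r1[of 1 1 1 3] r1[of 1 1 1 2] r1[of 2 2 1 3] r1[of 2 2 1 2] r1[of 3 3 1 3] r1[of 3 3 1 2]
      r1[of 2 3 1 3] r1[of 2 3 1 2]
    by (simp_all add: act4_nested sum_3 rot_e1_pi block_def)
  \<comment> \<open>The same facts with the index pairs exchanged: the simplifier orders the pairs in either way.\<close>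
  have z': "E$1$3$1$1 = 0" "E$1$2$1$1 = 0" "E$1$3$2$2 = 0" "E$1$2$2$2 = 0" "E$1$3$3$3 = 0" "E$1$2$3$3 = 0"
     "E$1$3$2$3 = 0" "E$1$2$2$3 = 0"
    using z s by metis+
  define w where "w = sqrt 3"
  have w: "w * w = 3" "w * (w * x) = 3 * x" for x by (simp_all add: w_def mult.assoc[symmetric])
  have r3: "act4 (block (-1/2) (- w / 2) (w / 2) (-1/2) 1) E $i$j$k$l = E$i$j$k$l" for i j k l
    using r3 by (simp add: rot_120 w_def)
  note S = act4_nested sum_3 block_def z z' s s' field_simps w
  have "16 * E$1$1$1$1 = E$1$1$1$1 + 9 * E$2$2$2$2 + 6 * E$1$1$2$2 + 12 * E$1$2$1$2"
    using r3[of 1 1 1 1] by (simp add: S; linarith)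
  moreover have "16 * E$2$2$2$2 = 9 * E$1$1$1$1 + E$2$2$2$2 + 6 * E$1$1$2$2 + 12 * E$1$2$1$2"
    using r3[of 2 2 2 2] by (simp add: S; linarith)
  moreover have "4 * E$1$1$3$3 = E$1$1$3$3 + 3 * E$2$2$3$3"
    using r3[of 1 1 3 3] by (simp add: S; linarith)
  moreover have "4 * E$2$3$2$3 = E$2$3$2$3 + 3 * E$1$3$1$3"
    using r3[of 2 3 2 3] by (simp add: S; linarith)
  moreover have "2 * E$3$3$2$3 = - E$3$3$2$3"
    using r3[of 3 3 2 3] by (simp add: S; linarith)
  moreover have "8 * E$1$1$2$3 = - E$1$1$2$3 - 3 * E$2$2$2$3 + 6 * E$1$3$1$2"
    using r3[of 1 1 2 3] by (simp add: S; linarith)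
  moreover have "8 * E$2$2$2$3 = - 3 * E$1$1$2$3 - E$2$2$2$3 - 6 * E$1$3$1$2"
    using r3[of 2 2 2 3] by (simp add: S; linarith)
  moreover have "8 * E$1$3$1$2 = 2 * E$1$3$1$2 + 3 * E$1$1$2$3 - 3 * E$2$2$2$3"
    using r3[of 1 3 1 2] by (simp add: S; linarith)
  ultimately show ?thesis
    by (intro Ela_ext[OF E trig_Ela]; simp add: trig_def Let_def z; linarith)
qed

text \<open>
  For \<open>w = \<plusminus>\<surd>2\<close>, the rotation by \<open>\<pi>\<close> about the unit vector \<open>n\<close> with components \<open>0, w / \<surd>3, 1 / \<surd>3\<close>,
  that is, the matrix of \<open>2 n \<otimes> n - q\<close>. The vector \<open>n\<close> spans an edge of a cube that has \<open>e\<^sub>3\<close> as a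
  body diagonal.
\<close>
definition cubic_rot :: "real \<Rightarrow> real^3^3" where
  "cubic_rot w = vector [vector [-1, 0, 0], vector [0, 1/3, 2*w/3], vector [0, 2*w/3, -1/3]]"

lemma cubic_rot_in_SO3:
  assumes w: "w * w = 2" shows "cubic_rot w \<in> carrier SO3"
  using w by (simp add: carrier_SO3 orthogonal_matrix vec_eq_iff forall_3 matrix_matrix_mult_def transpose_def
    mat_def sum_3 cubic_rot_def det_3)

text \<open>
  The tensor is the isotropic one with elastic moduli \<open>\<lambda> = l\<close> and \<open>\<mu> = m\<close> plus the harmonic one
  with \<open>h = 8 k\<close> and \<open>s = 5 w k\<close>. So if the deviators of \<open>d\<close> and \<open>v\<close> vanish and \<open>c14\<close> has the
  exceptional ratio to \<open>h\<close> at which the deviator of \<open>d\<^sub>2\<close> vanishes as well, then the tensor has the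
  symmetry of a cube, and in particular this half-turn.
\<close>
lemma cubic_fixed:
  assumes w: "w * w = 2"
  defines "T \<equiv> \<lambda>l m k. trig (l + 2 * m + 3 * k) (l + 2 * m + 8 * k) (l + k) (l - 4 * k) (m - 4 * k) (5 * w * k)"
  shows "act4 (cubic_rot w) (T l m k) = T l m k"
proof -
  have w: "w * w = 2" "w * (w * x) = 2 * x" for x using w by (simp_all add: mult.assoc[symmetric])
  show ?thesis
    unfolding T_def
    by (rule Ela_ext[OF act4_Ela[OF trig_Ela] trig_Ela])
      (simp_all add: act4_nested sum_3 cubic_rot_def trig_def Let_def, simp_all add: field_simps w)
qed

section \<open>The trigonal stratum\<close>

text \<open>
  A symmetry of the tensor is a symmetry of \<open>d\<close> and of \<open>v\<close>. One of these is not spherical, so the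
  symmetry preserves the line of \<open>e\<^sub>3\<close>. It then has to preserve the form \<open>E\<^sub>i\<^sub>j\<^sub>k\<^sub>3 x\<^sub>i x\<^sub>j x\<^sub>k = c14 (3
  x\<^sub>1\<^sup>2 x\<^sub>2 - x\<^sub>2\<^sup>3)\<close> on the orthogonal plane up to the sign of its action on \<open>e\<^sub>3\<close>. This form is \<open>c14\<close>
  times the imaginary part of \<open>(x\<^sub>1 + \<i> x\<^sub>2)\<^sup>3\<close>, so only six rotations are left.
\<close>
lemma trig_symmetry_group:
  assumes nz: "c11 + c12 \<noteq> c13 + c33 \<or> c11 + (c11 - c12) / 2 \<noteq> c44 + c33" and s: "c14 \<noteq> 0"
  shows "symmetry_group (trig c11 c33 c12 c13 c44 c14) = D3"
proof (intro equalityI subsetI)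
  let ?T = "trig c11 c33 c12 c13 c44 c14"
  fix g assume "g \<in> symmetry_group ?T"
  then have g: "orthogonal_matrix g" "det g = 1" and fixed: "act4 g ?T = ?T"
    by (simp_all add: symmetry_group_def carrier_SO3)
  obtain x y where xy: "x \<noteq> y" "act2 g (diag3 x y) = diag3 x y"
  proof (cases "c11 + c12 = c13 + c33")
    case False
    have "act2 g (ela_d ?T) = ela_d ?T" using ela_d_act4[OF g(1), of ?T] fixed by simp
    with False show thesis by (intro that[of "c11 + c12 + c13" "2 * c13 + c33"]) (simp_all add: d_trig)
  next
    case True
    have "act2 g (ela_v ?T) = ela_v ?T" using ela_v_act4[OF g(1), of ?T] fixed by simp
    with True nz show thesis
      by (intro that[of "c11 + (c11 - c12) / 2 + c44" "2 * c44 + c33"]) (simp_all add: v_trig)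
  qed
  have "act2 g (diag3 x y) ** g = g ** diag3 x y"
    using g(1) by (simp add: act2_def orthogonal_matrix_def matrix_mul_assoc[symmetric])
  then have "g ** diag3 x y = diag3 x y ** g" using xy by simp
  then have "g$1$3 * y = x * g$1$3" "g$2$3 * y = x * g$2$3" "g$3$1 * x = y * g$3$1" "g$3$2 * x = y * g$3$2"
    by (simp_all add: vec_eq_iff forall_3 matrix_matrix_mult_def sum_3 diag3_def)
  then have zero: "g$1$3 = 0" "g$2$3 = 0" "g$3$1 = 0" "g$3$2 = 0"
    using xy(1) by (auto simp: mult.commute)
  define a b e where "a = g$1$1" and "b = g$1$2" and "e = g$3$3"
  have "g = block a b (g$2$1) (g$2$2) e"
    by (simp add: vec_eq_iff forall_3 block_def zero a_def b_def e_def)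
  then obtain c d where gb: "g = block a b c d e" by blast
  have "g ** transpose g = mat 1" using g(1) by (simp add: orthogonal_matrix_def)
  then have "block (a*a + b*b) (a*c + b*d) (c*a + d*b) (c*c + d*d) (e*e) = block 1 0 0 1 1"
    by (simp add: gb transpose_block mult_block mat1_block)
  then have o: "a*a + b*b = 1" "a*c + b*d = 0" "e*e = 1"
    by (simp_all add: vec_eq_iff forall_3 block_def)
  have dt: "e * (a*d - b*c) = 1" using g(2) by (simp add: gb det_block)
  have e: "e = 1 \<or> e = -1" using o(3) by (simp add: square_eq_1_iff)
  have D: "a*d - b*c = e" using e dt by auto
  have "d = (a*a + b*b) * d" using o(1) by simp
  also have "\<dots> = a * (a*d - b*c) + b * (a*c + b*d)" by algebra
  finally have d: "d = e * a" using o D by simp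
  have "c = (a*a + b*b) * c" using o(1) by simp
  also have "\<dots> = a * (a*c + b*d) - b * (a*d - b*c)" by algebra
  finally have c: "c = - e * b" using o D by simp
  have "act4 g ?T $2$2$2$3 = - c14" using fixed by (simp add: trig_def Let_def)
  then have "e * (3 * c*c*d - d*d*d) * c14 = - c14"
    by (simp add: gb act4_nested sum_3 block_def trig_def Let_def algebra_simps)
  then have "e * (3 * c*c*d - d*d*d) = -1" using s
    by (metis mult_cancel_right mult_minus1)
  then have "3 * b*b*a - a*a*a = -1" using e by (auto simp: c d)
  moreover have bb: "b*b = 1 - a*a" using o(1) by simp
  ultimately have "3 * (1 - a*a) * a - a*a*a = -1" by (metis mult.assoc)
  \<comment> \<open>The equation is \<open>4 a\<^sup>3 - 3 a = 1\<close>, the triple angle formula for the cosine \<open>a\<close>.\<close>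
  then have "(a - 1) * (2 * a + 1) * (2 * a + 1) = 0" by (simp add: algebra_simps)
  then have "a = 1 \<or> a = -1/2" by auto
  moreover have "b = 0" if "a = 1" using bb that by simp
  moreover have "b = sqrt 3 / 2 \<or> b = - sqrt 3 / 2" if "a = -1/2"
  proof -
    have "(b - sqrt 3 / 2) * (b + sqrt 3 / 2) = 0"
      using bb that by (simp add: algebra_simps)
    then show ?thesis by (auto simp: eq_neg_iff_add_eq_0)
  qed
  ultimately have ab: "a = 1 \<and> b = 0 \<or> a = -1/2 \<and> b = - sqrt 3 / 2 \<or> a = -1/2 \<and> b = sqrt 3 / 2" by blast
  let ?R = "rot_e3 (2 * pi / 3)" and ?S = "rot_e1 pi"
  have mult: "h ** k \<in> D3" if "h \<in> D3" "k \<in> D3" for h k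
    using generate.eng[of h SO3 _ k] that unfolding D3_def mult_SO3 by blast
  have one: "mat 1 \<in> D3" using generate.one[of SO3] unfolding D3_def one_SO3 by blast
  have B: "block a b (- b) a 1 \<in> D3"
  proof -
    have "block a b (- b) a 1 \<in> {mat 1, ?R, ?R ** ?R}"
      using ab by (elim disjE conjE) (simp_all only: mat1_block rot_120 mult_block, simp_all)
    moreover have "{mat 1, ?R, ?R ** ?R} \<subseteq> D3"
      by (simp add: one mult generators_D3)
    ultimately show ?thesis by (rule rev_subsetD)
  qed
  show "g \<in> D3"
    using e
  proof
    assume "e = 1" then show ?thesis using B by (simp add: gb c d)
  next
    assume "e = -1"
    then have "g = ?S ** block a b (- b) a 1" by (simp add: gb c d rot_e1_pi mult_block)
    with B show ?thesis by (simp add: mult generators_D3)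
  qed
next
  fix g assume "g \<in> D3" 
  then show "g \<in> symmetry_group (trig c11 c33 c12 c13 c44 c14)"
    using D3_subset_symmetry_group[OF trig_rot_e3_120 trig_rot_e1_pi] by blast
qed

text \<open>
  Each element of \<^const>\<open>D3\<close> preserves the line of \<open>e\<^sub>3\<close>. It fixes the trigonal tensor used in the proof,
  whose tensor \<open>d\<close> is not spherical, and hence commutes with \<open>d\<close>.
\<close>
lemma D3_nth_2_3:
  assumes "g \<in> D3" shows "g$2$3 = 0"
proof -
  have "act4 g (trig 0 0 1 0 0 1) = trig 0 0 1 0 0 1"
    using assms trig_symmetry_group[of 0 1 0 0 0 1] by (auto simp: symmetry_group_def)
  moreover have o: "orthogonal_matrix g" using assms D3_carrier by (auto simp: carrier_SO3)
  ultimately have "act2 g (diag3 1 0) = diag3 1 0"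
    using ela_d_act4[OF o, of "trig 0 0 1 0 0 1"] by (simp add: d_trig)
  moreover have "act2 g (diag3 1 0) ** g = g ** diag3 1 0"
    using o by (simp add: act2_def orthogonal_matrix_def matrix_mul_assoc[symmetric])
  ultimately have "g ** diag3 1 0 = diag3 1 0 ** g" by simp
  then show ?thesis
    by (simp add: vec_eq_iff forall_3 matrix_matrix_mult_def sum_3 diag3_def)
qed

text \<open>
  The disjunction says that the denominator of \<open>t\<close> does not vanish: otherwise a rotation about
  the edge of a cube would be a further symmetry.
\<close>
lemma symmetry_D3_trig:
  assumes E: "E \<in> Ela" and D: "symmetry_group E = D3"
  obtains c11 c33 c12 c13 c44 c14 where "E = trig c11 c33 c12 c13 c44 c14"
    "c11 + c12 \<noteq> c13 + c33 \<or> c11 + (c11 - c12) / 2 \<noteq> c44 + c33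
       \<or> 25 * (8/35 * (c11 + c33 - 2 * c13 - 4 * c44))\<^sup>2 \<noteq> 32 * c14\<^sup>2"
proof -
  have "act4 (rot_e3 (2 * pi / 3)) E = E" "act4 (rot_e1 pi) E = E"
    using generators_D3 by (auto simp: D[symmetric] symmetry_group_def)
  from D3_fixed_imp_trig[OF E this] obtain c11 c33 c12 c13 c44 c14 where T: "E = trig c11 c33 c12 c13 c44 c14"
    by blast
  have False if "c11 + c12 = c13 + c33" "c11 + (c11 - c12) / 2 = c44 + c33"
    "25 * (8/35 * (c11 + c33 - 2 * c13 - 4 * c44))\<^sup>2 = 32 * c14\<^sup>2"
  proof -
    define k where "k = (c11 + c33 - 2 * c13 - 4 * c44) / 35"
    define l where "l = c12 - k"
    define m where "m = c44 + 4 * k"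
    have "8/35 * (c11 + c33 - 2 * c13 - 4 * c44) = 8 * k" by (simp add: k_def)
    with that(3) have "c14\<^sup>2 = (5 * sqrt 2 * k)\<^sup>2" by (simp add: power_mult_distrib)
    then have "c14 = 5 * sqrt 2 * k \<or> c14 = 5 * (- sqrt 2) * k"
      by (auto simp: power2_eq_iff)
    then obtain w :: real where w: "w * w = 2" "c14 = 5 * w * k"
    proof
      assume "c14 = 5 * sqrt 2 * k" then show thesis by (intro that[of "sqrt 2"]) simp_all
    next
      assume "c14 = 5 * (- sqrt 2) * k" then show thesis by (intro that[of "- sqrt 2"]) simp_all
    qed
    have lin: "c11 = l + 2 * m + 3 * k" "c33 = l + 2 * m + 8 * k" "c12 = l + k" "c13 = l - 4 * k" "c44 = m - 4 * k"
      using that(1,2) k_def unfolding l_def m_def by (simp_all add: field_simps)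
    have "cubic_rot w \<in> symmetry_group E"
      using cubic_fixed[OF w(1), of l m k] cubic_rot_in_SO3[OF w(1)] unfolding symmetry_group_def T w(2) lin by simp
    then have "cubic_rot w $ 2 $ 3 = 0" using D3_nth_2_3 D by blast
    then show False using w by (auto simp: cubic_rot_def)
  qed
  with T that show thesis by blast
qed

section \<open>The invariants and functional bases\<close>

text \<open>
  The six invariants, as a list.
\<close>
definition kappas :: "(tensor4 \<Rightarrow> real) list" where
  "kappas = [\<lambda>E. trace (ela_d E),
     \<lambda>E. trace (ela_v E),
     \<lambda>E. ela_d E \<bullet> ela_t E,
     \<lambda>E. ela_v E \<bullet> ela_t E,
     \<lambda>E. contract4 (ela_t E) (ela_H E) (ela_t E),
     \<lambda>E. ela_I2 E]"

lemma kappas_invariant: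
  assumes "g \<in> carrier SO3" "\<phi> \<in> set kappas"
  shows "\<phi> (act4 g E) = \<phi> E"
proof -
  have "orthogonal_matrix g" using assms(1) by (simp add: carrier_SO3)
  then show ?thesis using assms(2)
    by (auto simp: kappas_def ela_d_act4 ela_v_act4 ela_t_act4 ela_H_act4 ela_d2_act4 ela_I2_def trace_act2
       inner_act2 contract4_act)
qed

lemma kappas_trig:
  assumes h: "h = 8/35 * (c11 + c33 - 2 * c13 - 4 * c44)"
    and nz: "c11 + c12 \<noteq> c13 + c33 \<or> c11 + (c11 - c12) / 2 \<noteq> c44 + c33 \<or> 25 * h\<^sup>2 \<noteq> 32 * c14\<^sup>2"
  shows "map (\<lambda>\<phi>. \<phi> (trig c11 c33 c12 c13 c44 c14)) kappas =
    [2 * c11 + 2 * c12 + 4 * c13 + c33, 3 * c11 - c12 + 4 * c44 + c33,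
     2/3 * (c13 + c33 - (c11 + c12)), 2/3 * (c44 + c33 - (c11 + (c11 - c12) / 2)),
     h, 35/8 * h\<^sup>2 + 16 * c14\<^sup>2]"
  unfolding kappas_def list.map
  unfolding d_trig v_trig t_trig[OF h nz] H_trig h[symmetric] contract4_axial I2_trig[OF h] 
  unfolding axial_def diag3_simps
  by (simp add: field_simps)

text \<open>
  Invariants that separate the orbits form a functional basis: \<open>F\<close> evaluates \<open>f\<close> at an arbitrary
  point with the given values.
\<close>
lemma functional_basisI:
  assumes stable: "SO3_stable X" and inv: "\<And>\<phi>. \<phi> \<in> set \<phi>s \<Longrightarrow> SO3_invariant_on X \<phi>"
    and sep: "\<And>x y. x \<in> X \<Longrightarrow> y \<in> X \<Longrightarrow> map (\<lambda>\<phi>. \<phi> x) \<phi>s = map (\<lambda>\<phi>. \<phi> y) \<phi>s \<Longrightarrow> \<exists>g\<in>carrier SO3. y = act4 g x"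
  shows "functional_basis X \<phi>s"
proof -
  have "\<exists>F. \<forall>x\<in>X. f x = F (map (\<lambda>\<phi>. \<phi> x) \<phi>s)" if f: "SO3_invariant_on X f" for f
  proof (intro exI ballI)
    fix x assume x: "x \<in> X"
    let ?P = "\<lambda>y. y \<in> X \<and> map (\<lambda>\<phi>. \<phi> y) \<phi>s = map (\<lambda>\<phi>. \<phi> x) \<phi>s"
    have "?P (SOME y. ?P y)" by (rule someI[of ?P x]) (simp add: x)
    with sep[of "SOME y. ?P y" x] x obtain g where g: "g \<in> carrier SO3" "x = act4 g (SOME y. ?P y)"
      by auto
    have "f (act4 g (SOME y. ?P y)) = f (SOME y. ?P y)"
      using f g(1) \<open>?P (SOME y. ?P y)\<close> unfolding SO3_invariant_on_def by blast
    with g(2) show "f x = (\<lambda>l. f (SOME y. y \<in> X \<and> map (\<lambda>\<phi>. \<phi> y) \<phi>s = l)) (map (\<lambda>\<phi>. \<phi> x) \<phi>s)"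
      by simp
  qed
  with stable inv show ?thesis by (auto simp: functional_basis_def)
qed

text \<open>
  A functional basis is minimal if each member takes different values at some two points at
  which all other members agree: such a member is not a function of the others.
\<close>
lemma minimal_functional_basisI:
  assumes basis: "functional_basis X \<phi>s"
    and indep: "\<And>i. i < length \<phi>s \<Longrightarrow> \<exists>x\<in>X. \<exists>y\<in>X. (\<phi>s!i) x \<noteq> (\<phi>s!i) y \<and>
                  (\<forall>j<length \<phi>s. j \<noteq> i \<longrightarrow> (\<phi>s!j) x = (\<phi>s!j) y)"
  shows "minimal_functional_basis X \<phi>s"
proof -
  have False if J: "J \<subset> {..<length \<phi>s}" and B: "functional_basis X (nths \<phi>s J)" for J
  proof -
    obtain i where i: "i < length \<phi>s" "i \<notin> J" using J by blast
    obtain x y where xy: "x \<in> X" "y \<in> X" "(\<phi>s!i) x \<noteq> (\<phi>s!i) y"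
      "\<And>j. j < length \<phi>s \<Longrightarrow> j \<noteq> i \<Longrightarrow> (\<phi>s!j) x = (\<phi>s!j) y"
      using indep[OF i(1)] by blast
    have same: "map (\<lambda>\<phi>. \<phi> x) (nths \<phi>s J) = map (\<lambda>\<phi>. \<phi> y) (nths \<phi>s J)"
      using i(2) xy(4) by (auto simp: set_nths)
    have inv: "SO3_invariant_on X (\<phi>s!i)"
      using basis i(1) by (simp add: functional_basis_def)
    obtain F where F: "\<And>z. z \<in> X \<Longrightarrow> (\<phi>s!i) z = F (map (\<lambda>\<phi>. \<phi> z) (nths \<phi>s J))"
      using B inv unfolding functional_basis_def by blast
    have "(\<phi>s!i) x = (\<phi>s!i) y"
      unfolding F[OF xy(1)] F[OF xy(2)] same ..
    with xy(3) show False ..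
  qed
  with basis show ?thesis unfolding minimal_functional_basis_def by blast
qed

lemma kappas_separate:
  assumes "E \<in> stratum D3" "F \<in> stratum D3"
    and eq: "map (\<lambda>\<phi>. \<phi> E) kappas = map (\<lambda>\<phi>. \<phi> F) kappas"
  shows "\<exists>g\<in>carrier SO3. F = act4 g E"
proof -
  obtain g E0 where g: "g \<in> carrier SO3" "E0 \<in> Ela" "symmetry_group E0 = D3" "E = act4 g E0"
    using stratum_representative[OF assms(1) D3_carrier] .
  obtain k F0 where k: "k \<in> carrier SO3" "F0 \<in> Ela" "symmetry_group F0 = D3" "F = act4 k F0"
    using stratum_representative[OF assms(2) D3_carrier] .
  obtain c11 c33 c12 c13 c44 c14 where E0: "E0 = trig c11 c33 c12 c13 c44 c14"
    and nE: "c11 + c12 \<noteq> c13 + c33 \<or> c11 + (c11 - c12) / 2 \<noteq> c44 + c33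
       \<or> 25 * (8/35 * (c11 + c33 - 2 * c13 - 4 * c44))\<^sup>2 \<noteq> 32 * c14\<^sup>2"
    using symmetry_D3_trig[OF g(2,3)] .
  obtain d11 d33 d12 d13 d44 d14 where F0: "F0 = trig d11 d33 d12 d13 d44 d14"
    and nF: "d11 + d12 \<noteq> d13 + d33 \<or> d11 + (d11 - d12) / 2 \<noteq> d44 + d33
       \<or> 25 * (8/35 * (d11 + d33 - 2 * d13 - 4 * d44))\<^sup>2 \<noteq> 32 * d14\<^sup>2"
    using symmetry_D3_trig[OF k(2,3)] .
  define h where "h = 8/35 * (c11 + c33 - 2 * c13 - 4 * c44)"
  define h' where "h' = 8/35 * (d11 + d33 - 2 * d13 - 4 * d44)"
  have "map (\<lambda>\<phi>. \<phi> E0) kappas = map (\<lambda>\<phi>. \<phi> F0) kappas"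
    using eq by (simp add: g(4) k(4) kappas_invariant[OF g(1)] kappas_invariant[OF k(1)] cong: map_cong)
  then have "[2 * c11 + 2 * c12 + 4 * c13 + c33, 3 * c11 - c12 + 4 * c44 + c33,
     2/3 * (c13 + c33 - (c11 + c12)), 2/3 * (c44 + c33 - (c11 + (c11 - c12) / 2)),
     h, 35/8 * h\<^sup>2 + 16 * c14\<^sup>2] =
    [2 * d11 + 2 * d12 + 4 * d13 + d33, 3 * d11 - d12 + 4 * d44 + d33,
     2/3 * (d13 + d33 - (d11 + d12)), 2/3 * (d44 + d33 - (d11 + (d11 - d12) / 2)),
     h', 35/8 * h'\<^sup>2 + 16 * d14\<^sup>2]"
    unfolding E0 F0 kappas_trig[OF h_def nE[folded h_def]] kappas_trig[OF h'_def nF[folded h'_def]] .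
  then have eqs: "2 * c11 + 2 * c12 + 4 * c13 + c33 = 2 * d11 + 2 * d12 + 4 * d13 + d33"
    "3 * c11 - c12 + 4 * c44 + c33 = 3 * d11 - d12 + 4 * d44 + d33"
    "2/3 * (c13 + c33 - (c11 + c12)) = 2/3 * (d13 + d33 - (d11 + d12))"
    "2/3 * (c44 + c33 - (c11 + (c11 - c12) / 2)) = 2/3 * (d44 + d33 - (d11 + (d11 - d12) / 2))"
    "h = h'" "35/8 * h\<^sup>2 + 16 * c14\<^sup>2 = 35/8 * h'\<^sup>2 + 16 * d14\<^sup>2"
    unfolding list.inject by blast+
  have e: "c13 + c33 - c11 - c12 = d13 + d33 - d11 - d12"
    "2 * c44 + 2 * c33 - 3 * c11 + c12 = 2 * d44 + 2 * d33 - 3 * d11 + d12"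
    "c11 + c33 - 2 * c13 - 4 * c44 = d11 + d33 - 2 * d13 - 4 * d44"
    using eqs(3,4,5) by (simp_all add: h_def h'_def field_simps)
  have lin: "d11 = c11" "d33 = c33" "d12 = c12" "d13 = c13" "d44 = c44"
    using eqs(1,2) e by algebra+
  have "d14\<^sup>2 = c14\<^sup>2" using eqs(5,6) by simp
  then have "d14 = c14 \<or> d14 = - c14" by (simp add: power2_eq_iff)
  then obtain r where r: "r \<in> carrier SO3" "F0 = act4 r E0"
  proof
    assume "d14 = c14"
    then show thesis
      by (intro that[of "mat 1"]) (simp_all add: E0 F0 lin act4_mat_1 carrier_SO3 orthogonal_matrix_id)
  next
    assume "d14 = - c14"
    then show thesis by (intro that[of "rot_e3 pi"]) (simp_all add: E0 F0 lin trig_rot_e3_pi rot_e3_in_SO3)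
  qed
  have "act4 (k ** r ** transpose g) E = F"
    by (simp add: act4_mult g(4) k(4) r(2) act4_inverse(1)[OF g(1)])
  moreover have "k ** r ** transpose g \<in> carrier SO3"
    by (intro mult_in_SO3 transpose_SO3 g k r)
  ultimately show ?thesis by metis
qed

text \<open>
  The witness comes from inverting the formulas of \<open>kappas_trig\<close>: \<open>d1, d3\<close> are the entries of \<open>d\<close>
  and \<open>v1, v3\<close> those of \<open>v\<close>, and together with \<open>h\<close> they determine the elastic constants other than
  \<open>c14\<close>.
\<close>
lemma kappas_surj:
  assumes "x \<noteq> 0 \<or> y \<noteq> 0" "s \<noteq> 0"
  shows "\<exists>E\<in>stratum D3. map (\<lambda>\<phi>. \<phi> E) kappas = [a, b, x, y, h, 35/8 * h\<^sup>2 + 16 * s\<^sup>2]"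
proof -
  define d1 where "d1 = (a - 3/2 * x) / 3"
  define d3 where "d3 = (a + 3 * x) / 3"
  define v1 where "v1 = (b - 3/2 * y) / 3"
  define v3 where "v3 = (b + 3 * y) / 3"
  define c33 where "c33 = h + (9 * d3 + 18 * v3 - 2 * d1 - 4 * v1) / 35"
  define c13 where "c13 = (d3 - c33) / 2"
  define c44 where "c44 = (v3 - c33) / 2"
  define c11 where "c11 = 35 * h / 8 + d3 + 2 * v3 - 4 * c33"
  define c12 where "c12 = d1 - c11 - c13"
  have h: "h = 8/35 * (c11 + c33 - 2 * c13 - 4 * c44)"
    and "c11 + c12 + c13 = d1" "2 * c13 + c33 = d3" "2 * c44 + c33 = v3" "c11 + (c11 - c12) / 2 + c44 = v1"
    unfolding c12_def c11_def c44_def c13_def c33_def by (simp_all add: field_simps)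
  moreover have "2 * d1 + d3 = a" "2/3 * (d3 - d1) = x" "2 * v1 + v3 = b" "2/3 * (v3 - v1) = y"
    unfolding v3_def v1_def d3_def d1_def by (simp_all add: field_simps)
  ultimately have e: "2 * c11 + 2 * c12 + 4 * c13 + c33 = a" "3 * c11 - c12 + 4 * c44 + c33 = b"
    "2/3 * (c13 + c33 - (c11 + c12)) = x" "2/3 * (c44 + c33 - (c11 + (c11 - c12) / 2)) = y"
    by (simp_all add: field_simps)
  have nz: "c11 + c12 \<noteq> c13 + c33 \<or> c11 + (c11 - c12) / 2 \<noteq> c44 + c33"
  proof -
    have "x = 0" if "c11 + c12 = c13 + c33" using e(3) that by simp
    moreover have "y = 0" if "c11 + (c11 - c12) / 2 = c44 + c33" using e(4) that by simp
    ultimately show ?thesis using assms(1) by blast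
  qed
  have "trig c11 c33 c12 c13 c44 s \<in> stratum D3"
    using in_stratum_self[OF trig_Ela[of c11 c33 c12 c13 c44 s]]
    unfolding trig_symmetry_group[OF nz assms(2)] .
  moreover from nz have "c11 + c12 \<noteq> c13 + c33 \<or> c11 + (c11 - c12) / 2 \<noteq> c44 + c33 \<or> 25 * h\<^sup>2 \<noteq> 32 * s\<^sup>2"
    by blast
  then have "map (\<lambda>\<phi>. \<phi> (trig c11 c33 c12 c13 c44 s)) kappas = [a, b, x, y, h, 35/8 * h\<^sup>2 + 16 * s\<^sup>2]"
    by (simp only: kappas_trig[OF h] e)
  ultimately show ?thesis by (rule bexI[rotated])
qed

section \<open>The minimal functional basis of the trigonal stratum\<close>

theorem theorem6p5:
  shows "minimal_functional_basis (stratum D3)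
    [\<lambda>E. trace (ela_d E),
     \<lambda>E. trace (ela_v E),
     \<lambda>E. ela_d E \<bullet> ela_t E,
     \<lambda>E. ela_v E \<bullet> ela_t E,
     \<lambda>E. contract4 (ela_t E) (ela_H E) (ela_t E),
     \<lambda>E. ela_I2 E]"
  unfolding kappas_def[symmetric]
proof (rule minimal_functional_basisI)
  show "functional_basis (stratum D3) kappas"
    using kappas_invariant kappas_separate stratum_stable
    by (intro functional_basisI) (auto simp: SO3_invariant_on_def)
next
  fix i assume "i < length kappas"
  moreover have len: "length kappas = 6" by (simp add: kappas_def)
  ultimately have i: "i < 6" by simp
  let ?P = "\<lambda>l. \<exists>E\<in>stratum D3. map (\<lambda>\<phi>. \<phi> E) kappas = l"
  \<comment> \<open>The reference values; for each \<open>i\<close> there is a tensor whose values differ only at position \<open>i\<close>.\<close>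
  define l :: "real list" where "l = [0, 0, 1, 1, 1, 35/8 + 16]"
  have P: "?P [a, b, x, y, h, 35/8 * h\<^sup>2 + 16 * s\<^sup>2]" if "x \<noteq> 0" "s \<noteq> 0" for a b x y h s
    using kappas_surj that by blast
  have base: "?P l"
    using P[of 1 1 0 0 1 1] by (simp add: l_def)
  consider "i = 0" | "i = 1" | "i = 2" | "i = 3" | "i = 4" | "i = 5" using i by linarith
  then obtain c where c: "c \<noteq> l ! i" "?P (l[i := c])"
  proof cases
    case 1 then show thesis using P[of 1 1 1 0 1 1] by (intro that[of 1]) (simp_all add: l_def)
  next
    case 2 then show thesis using P[of 1 1 0 1 1 1] by (intro that[of 1]) (simp_all add: l_def)
  next
    case 3 then show thesis using P[of 2 1 0 0 1 1] by (intro that[of 2]) (simp_all add: l_def numeral_2_eq_2)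
  next
    case 4 then show thesis using P[of 1 1 0 0 2 1] by (intro that[of 2]) (simp_all add: l_def numeral_3_eq_3)
  next
    case 5 then show thesis using P[of 1 1 0 0 1 "-1"] by (intro that[of "-1"]) (simp_all add: l_def numeral_eq_Suc)
  next
    case 6 then show thesis using P[of 1 2 0 0 1 1] by (intro that[of "35/8 + 64"]) (simp_all add: l_def numeral_eq_Suc)
  qed
  from base obtain E where E: "E \<in> stratum D3" "map (\<lambda>\<phi>. \<phi> E) kappas = l" by blast
  from c(2) obtain F where F: "F \<in> stratum D3" "map (\<lambda>\<phi>. \<phi> F) kappas = l[i := c]" by blast
  have val: "(kappas ! j) E = l ! j" "(kappas ! j) F = l[i := c] ! j" if "j < length kappas" for j
    using nth_map[OF that, of "\<lambda>\<phi>. \<phi> E"] nth_map[OF that, of "\<lambda>\<phi>. \<phi> F"] unfolding E(2) F(2) by simp_all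
  have "length l = 6" by (simp add: l_def)
  then show "\<exists>x\<in>stratum D3. \<exists>y\<in>stratum D3. (kappas ! i) x \<noteq> (kappas ! i) y \<and>
                  (\<forall>j<length kappas. j \<noteq> i \<longrightarrow> (kappas ! j) x = (kappas ! j) y)"
    using E(1) F(1) val c(1) i len by (intro bexI[of _ E] bexI[of _ F]) auto
qed

end
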